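(* Let $1\le p\le 2$. Let $A\colon\Omega\to\mathcal{L}(\ell_p)$ be weakly measurable with $\|A(\omega)\|_{\mathcal{L}(\ell_p)}\le\rho$ for all $\omega$, for some constant $\rho<\infty$. Let $A_1,A_2,\dots$ be a sequence of independent weakly measurable random operators $\Omega\to\mathcal{L}(\ell_p)$, each identically distributed with $A$. Put $W_n(t):=e^{A_1t/n}e^{A_2t/n}\cdots e^{A_nt/n}$. Then for every $x\in\ell_p$, every $T>0$ and every $\varepsilon>0$, $$\lim_{n\to\infty}\Pr\Big\{\sup_{t\in[0,T]}\big\|\big(W_n(t)-e^{t\,\mathbb{E}A}\big)x\big\|_{\ell_2}>\varepsilon\Big\}=0.$$ (Here $\ell_p\subset\ell_2$, so the $\ell_2$-norm is defined.)
   Context: $(\Omega,\mathcal{F},\Pr)$ is a probability space; scalars are $\mathbb{R}$ or $\mathbb{C}$; $\ell_p$ is indexed by $\mathbb{N}$; $\mathcal{L}(\ell_p)$ is the Banach algebra of bounded linear operators on $\ell_p$. $A\colon\Omega\to\mathcal{L}(X,Y)$ is weakly measurable if $\omega\mapsto\langle f,A(\omega)x\rangle$ is measurable for all $x\in X$, $f\in Y^*$. $\mathbb{E}A$ is the Pettis integral: the operator $E$ with $\mathbb{E}\langle f,Ax\rangle=\langle f,Ex\rangle$ for all $x,f$. Random operators $A_1,A_2,\dots$ are independent if for any functionals $f_i$ and vectors $x_i$ the scalar random variables $\langle f_i,A_ix_i\rangle$ are independent; $A_i$ is identically distributed with $A$ if for every finite family $(f_k,x_k)$ the joint law of $(\langle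 f_k,A_ix_k\rangle)_k$ equals that of $(\langle f_k,Ax_k\rangle)_k$. For bounded $B$, $e^{Bt}=\sum_{k\ge0}t^kB^k/k!$ (pointwise in $\omega$ for random $B$). *)

theory Defs
  imports "HOL-Probability.Probability"
begin

text \<open>Sequences over the scalar field 'k (real or complex; any complete
  second-countable real normed field) indexed by nat.\<close>

definition lp_space :: "real \<Rightarrow> (nat \<Rightarrow> 'k::real_normed_field) set" where
  "lp_space p = {x. summable (\<lambda>i. norm (x i) powr p)}"

definition lp_norm :: "real \<Rightarrow> (nat \<Rightarrow> 'k::real_normed_field) \<Rightarrow> real" where
  "lp_norm p x = (\<Sum>i. norm (x i) powr p) powr (1 / p)"

definition lp_dual :: "real \<Rightarrow> ((nat \<Rightarrow> 'k::real_normed_field) \<Rightarrow> 'k) \<Rightarrow> bool" where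
  "lp_dual p f \<longleftrightarrow>
     (\<forall>x\<in>lp_space p. \<forall>y\<in>lp_space p. f (\<lambda>i. x i + y i) = f x + f y) \<and>
     (\<forall>x\<in>lp_space p. \<forall>c. f (\<lambda>i. c * x i) = c * f x) \<and>
     (\<exists>C. \<forall>x\<in>lp_space p. norm (f x) \<le> C * lp_norm p x)"

text \<open>Bounded linear operators on l_p, i.e. elements of L(l_p)
  (only their values on l_p matter).\<close>
definition lp_op :: "real \<Rightarrow> ((nat \<Rightarrow> 'k::real_normed_field) \<Rightarrow> (nat \<Rightarrow> 'k)) \<Rightarrow> bool" where
  "lp_op p L \<longleftrightarrow>
     (\<forall>x\<in>lp_space p. L x \<in> lp_space p) \<and>
     (\<forall>x\<in>lp_space p. \<forall>y\<in>lp_space p. L (\<lambda>i. x i + y i) = (\<lambda>i. L x i + L y i)) \<and>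
     (\<forall>x\<in>lp_space p. \<forall>c. L (\<lambda>i. c * x i) = (\<lambda>i. c * L x i)) \<and>
     (\<exists>C. \<forall>x\<in>lp_space p. lp_norm p (L x) \<le> C * lp_norm p x)"

definition weakly_measurable ::
  "'w measure \<Rightarrow> real \<Rightarrow> ('w \<Rightarrow> (nat \<Rightarrow> 'k::{real_normed_field}) \<Rightarrow> (nat \<Rightarrow> 'k)) \<Rightarrow> bool" where
  "weakly_measurable M p A \<longleftrightarrow>
     (\<forall>x\<in>lp_space p. \<forall>f. lp_dual p f \<longrightarrow> (\<lambda>\<omega>. f (A \<omega> x)) \<in> borel_measurable M)"

definition is_pettis_integral ::
  "'w measure \<Rightarrow> real \<Rightarrow> ('w \<Rightarrow> (nat \<Rightarrow> 'k::{real_normed_field,banach,second_countable_topology}) \<Rightarrow> (nat \<Rightarrow> 'k))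
     \<Rightarrow> ((nat \<Rightarrow> 'k) \<Rightarrow> (nat \<Rightarrow> 'k)) \<Rightarrow> bool" where
  "is_pettis_integral M p A E \<longleftrightarrow> lp_op p E \<and>
     (\<forall>x\<in>lp_space p. \<forall>f. lp_dual p f \<longrightarrow>
        integrable M (\<lambda>\<omega>. f (A \<omega> x)) \<and> (\<integral>\<omega>. f (A \<omega> x) \<partial>M) = f (E x))"

definition pettis_expectation ::
  "'w measure \<Rightarrow> real \<Rightarrow> ('w \<Rightarrow> (nat \<Rightarrow> 'k::{real_normed_field,banach,second_countable_topology}) \<Rightarrow> (nat \<Rightarrow> 'k))
     \<Rightarrow> ((nat \<Rightarrow> 'k) \<Rightarrow> (nat \<Rightarrow> 'k))" where
  "pettis_expectation M p A = (SOME E. is_pettis_integral M p A E)"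

definition op_exp ::
  "real \<Rightarrow> ((nat \<Rightarrow> 'k::real_normed_field) \<Rightarrow> (nat \<Rightarrow> 'k)) \<Rightarrow> real \<Rightarrow> (nat \<Rightarrow> 'k) \<Rightarrow> (nat \<Rightarrow> 'k)" where
  "op_exp p B t x = (THE y. y \<in> lp_space p \<and>
      (\<lambda>N. lp_norm p (\<lambda>i. (\<Sum>k<N. of_real (t ^ k / fact k) * (B ^^ k) x i) - y i)) \<longlonglongrightarrow> 0)"

text \<open>W_n(t) = e^{A_1 t/n} ... e^{A_n t/n}; here the sequence is indexed from 0,
  so A_1,...,A_n are As 0, ..., As (n-1).\<close>
definition W_op ::
  "real \<Rightarrow> (nat \<Rightarrow> ((nat \<Rightarrow> 'k::real_normed_field) \<Rightarrow> (nat \<Rightarrow> 'k))) \<Rightarrow> nat \<Rightarrow> real \<Rightarrow> (nat \<Rightarrow> 'k) \<Rightarrow> (nat \<Rightarrow> 'k)" where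
  "W_op p Bs n t x = foldr (\<lambda>i y. op_exp p (Bs i) (t / real n) y) [0..<n] x"

text \<open>Outer probability (coincides with the probability on measurable events).\<close>
definition outer_prob :: "'w measure \<Rightarrow> 'w set \<Rightarrow> real" where
  "outer_prob M S = Inf {measure M B | B. B \<in> sets M \<and> S \<subseteq> B}"

end

theory Submission
  imports Defs
begin

text \<open>
  Replacing each factor \<open>exp (A_i t/n)\<close> of \<open>W_n(t)\<close> by \<open>1 + A_i t/n\<close> costs \<open>O(1/n)\<close> uniformly for \<open>t\<close> in \<open>[0,T]\<close>.
  Expanding the product gives the sum over \<open>m\<close> of \<open>(t/n)^m\<close> times the sum of \<open>A_w x\<close> over the increasing words
  \<open>w\<close> of length \<open>m\<close> in \<open>n\<close> letters, where \<open>A_w\<close> is the product of the \<open>A_i\<close> along \<open>w\<close>. If two words \<open>w\<close>, \<open>w'\<close> have no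
  common letter, every operator enters \<open>A_w x\<close> and \<open>A_w' x\<close> at most once and linearly, so the assumed independence
  makes \<open>A_w x - E^m x\<close> and \<open>A_w' x - E^m x\<close> orthogonal in mean. Only a fraction \<open>O(1/n)\<close> of the
  pairs of words meet, hence the normalized sum over words of length \<open>m\<close> tends to \<open>E^m x / m!\<close> in mean square
  in \<open>l_2\<close>, and \<open>l_2\<close>-norms are dominated by \<open>l_p\<close>-norms. Finitely many \<open>m\<close> suffice, the tails being
  dominated by the exponential series.

  Orthogonality needs the norm of the scalars to be Hilbertian. By Ostrowski's theorem a real normed field embeds
  isometrically into the complex numbers.
\<close>

section \<open>Real normed fields embed into the complex numbers\<close>

text \<open>Three weak hypotheses shape the proof. Independence concerns one scalar
  \<open>f_i (A_i x_i)\<close> per operator, so a word in which \<open>A_i\<close> acts on a random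
  vector must be broken into matrix entries before any expectation factors. Equality of laws
  transfers the bound \<open>\<rho>\<close> to \<open>A_i\<close> only almost surely and for one
  vector at a time; the exceptional sets are merged through a countable dense set of vectors.
  Finally, the supremum over \<open>t\<close> runs over an uncountable set and is never shown to be
  measurable, which is why outer probability occurs: for large \<open>n\<close> the event is covered
  by a null set and finitely many measurable events that do not depend on \<open>t\<close>, one for
  each word length below a cutoff \<open>K\<close>. The quantities are fixed in the order
  \<open>K\<close>, \<open>\<eta>\<close>, \<open>n\<close>: the cutoff controls the tails of the
  exponential series, \<open>\<eta>\<close> the random fluctuation at each length, and
  \<open>n\<close> everything else.\<close>

text \<open>Formally \<open>quadr u c = (u - c) * (u - cnj c)\<close>; this makes sense in every real field because the
  coefficients are real.\<close>

definition quadr :: "'k::real_normed_field \<Rightarrow> complex \<Rightarrow> 'k" where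
  "quadr u c = u\<^sup>2 - of_real (2 * Re c) * u + of_real ((cmod c)\<^sup>2)"

text \<open>Over the complex numbers, \<open>u^2 - d^2\<close> and \<open>u^2 - cnj d^2\<close>
  split into the four factors \<open>u - d\<close>, \<open>u + d\<close>, \<open>u - cnj d\<close>,
  \<open>u + cnj d\<close>; regrouping conjugate pairs gives the two quadratics.\<close>

lemma quadr_power2: "quadr ((u::'a::real_normed_field)\<^sup>2) (d\<^sup>2) = quadr u d * quadr u (- d)"
proof -
  have "2 * Re (d\<^sup>2) = 4 * (Re d)\<^sup>2 - 2 * (cmod d)\<^sup>2"
    unfolding cmod_power2 by (simp add: power2_eq_square)
  then have "(of_real (2 * Re (d\<^sup>2)) :: 'a) = of_real (4 * (Re d)\<^sup>2 - 2 * (cmod d)\<^sup>2)"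
    by (rule arg_cong)
  then have "(of_real (2 * Re (d\<^sup>2)) :: 'a) = 4 * (of_real (Re d))\<^sup>2 - 2 * (of_real (cmod d))\<^sup>2"
    by (simp only: of_real_diff of_real_mult of_real_numeral of_real_power)
  moreover have "(cmod (d\<^sup>2))\<^sup>2 = (cmod d)^4" by (simp add: norm_power)
  ultimately show ?thesis
    unfolding quadr_def by (simp only: of_real_power norm_minus_cancel uminus_complex.sel of_real_minus of_real_mult of_real_numeral)
      (simp add: power2_eq_square power4_eq_xxxx algebra_simps)
qed

lemma quadr_shift: "quadr (u + of_real r) (c + of_real r) = quadr u c"
proof -
  have "(cmod (c + of_real r))\<^sup>2 = (cmod c)\<^sup>2 + 2 * Re c * r + r\<^sup>2"
    by (simp add: cmod_power2 power2_sum)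
  then show ?thesis
    unfolding quadr_def by (simp add: power2_eq_square algebra_simps)
qed

text \<open>Since every complex \<open>c\<close> has a square root, \<open>quadr_power2\<close>
  writes each quadratic in \<open>u^2\<close> as a product of two quadratics in
  \<open>u\<close>.\<close>

lemma quadr_lower_power2:
  assumes "\<And>c. \<mu> \<le> norm (quadr u c)" "0 \<le> \<mu>"
  shows "\<mu>\<^sup>2 \<le> norm (quadr (u\<^sup>2) c)"
proof -
  define d where "d = csqrt c"
  have "\<mu> * \<mu> \<le> norm (quadr u d) * norm (quadr u (- d))"
    using assms by (intro mult_mono) auto
  then show ?thesis
    using quadr_power2[of u d] by (simp add: d_def norm_mult power2_eq_square[of \<mu>])
qed

lemma quadr_of_real: "quadr u (of_real r) = (u - of_real r)\<^sup>2"
  unfolding quadr_def by (simp add: power2_diff)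

lemma quadr_lower_diff:
  assumes "\<And>c. \<mu>\<^sup>2 \<le> norm (quadr u c)" "0 \<le> \<mu>"
  shows "\<mu> \<le> norm (u - of_real r)"
  using assms(1)[of "of_real r"] assms(2)
  by (simp add: quadr_of_real norm_power power_mono_iff[of \<mu> _ 2])

text \<open>Factor \<open>u^(2^k) - w^(2^k)\<close> into \<open>u - w\<close> and the sums
  \<open>u^(2^i) + w^(2^i)\<close> for \<open>i < k\<close>. Each sum is the distance of a power of
  \<open>u\<close> to a real number, hence at least \<open>\<mu>^(2^i)\<close>, and these exponents
  add up to \<open>2^k - 1\<close>.\<close>

lemma quadr_lower_powers:
  assumes "\<And>c. \<mu>\<^sup>2 \<le> norm (quadr u c)" "0 \<le> \<mu>"
  shows "norm (u - of_real w) * \<mu> ^ (2 ^ k - 1) \<le> norm (u ^ (2 ^ k) - of_real (w ^ (2 ^ k)))"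
proof -
  have "(\<forall>c. (\<mu> ^ (2 ^ k))\<^sup>2 \<le> norm (quadr (u ^ (2 ^ k)) c)) \<and>
    norm (u - of_real w) * \<mu> ^ (2 ^ k - 1) \<le> norm (u ^ (2 ^ k) - of_real (w ^ (2 ^ k)))"
  proof (induction k)
    case 0
    then show ?case using assms by simp
  next
    case (Suc k)
    let ?n = "2 ^ k :: nat"
    have pos: "?n > 0" by simp
    have e: "(2::nat) ^ Suc k = ?n * 2" by simp
    have 1: "(\<mu> ^ (2 ^ Suc k))\<^sup>2 \<le> norm (quadr (u ^ (2 ^ Suc k)) c)" for c
      using quadr_lower_power2[of "(\<mu> ^ ?n)\<^sup>2" "u ^ ?n" c] Suc assms(2)
      unfolding e power_mult by simp
    have 2: "\<mu> ^ ?n \<le> norm (u ^ ?n + of_real (w ^ ?n))"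
      using quadr_lower_diff[of "\<mu> ^ ?n" "u ^ ?n" "- (w ^ ?n)"] Suc assms(2) by simp
    have e3: "2 ^ Suc k - 1 = (?n - 1) + ?n" using pos by simp
    have "norm (u - of_real w) * \<mu> ^ (2 ^ Suc k - 1) =
        (norm (u - of_real w) * \<mu> ^ (?n - 1)) * \<mu> ^ ?n"
      unfolding e3 power_add by simp
    also have "\<dots> \<le> norm (u ^ ?n - of_real (w ^ ?n)) * norm (u ^ ?n + of_real (w ^ ?n))"
      using Suc 2 assms(2) by (intro mult_mono) auto
    also have "\<dots> = norm (u ^ (2 ^ Suc k) - of_real (w ^ (2 ^ Suc k)))"
      unfolding norm_mult[symmetric] e power_mult
      by (rule arg_cong[where f=norm]) (simp add: power2_eq_square algebra_simps)
    finally show ?case using 1 by blast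
  qed
  then show ?thesis by blast
qed

text \<open>Ostrowski's argument: if the minimum \<open>m\<close> of \<open>norm (quadr x c)\<close> over \<open>c\<close> were positive, take a minimizer
  \<open>z0\<close> of largest modulus and \<open>u = quadr x z0\<close>. Then \<open>norm (u + m / 2) > m\<close>, whereas factoring
  \<open>u ^ (2 ^ k) - (m / 2) ^ (2 ^ k)\<close> into quadratics of norm at least \<open>m\<close> forces \<open>norm (u + m / 2) / m\<close>
  below \<open>1 + (1 / 2) ^ (2 ^ k)\<close>.\<close>

lemma ostrowski_quadratic:
  fixes x :: "'k::real_normed_field"
  shows "\<exists>c. quadr x c = 0"
proof -
  define f where "f c = norm (quadr x c)" for c
  have cont: "continuous_on S f" for S
    unfolding f_def quadr_def by (intro continuous_intros)
  \<comment> \<open>Outside this radius the term \<open>(cmod c)^2\<close> dominates: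
    \<open>f c\<close> exceeds \<open>(norm x)^2\<close>, which is \<open>f 0\<close>. So the
    infimum may be sought on a compact disc.\<close>
  define R where "R = 4 * norm x + 1"
  have out: "f 0 < f c" if "cmod c > R" for c
  proof -
    have "norm (of_real ((cmod c)\<^sup>2) :: 'k) \<le> norm (quadr x c) + norm (- x\<^sup>2 + of_real (2 * Re c) * x)"
      unfolding quadr_def by (rule order_trans[OF _ norm_triangle_ineq]) (simp)
    also have "norm (- x\<^sup>2 + of_real (2 * Re c) * x) \<le> (norm x)\<^sup>2 + 2 * cmod c * norm x"
      by (rule order_trans[OF norm_triangle_ineq])
        (auto simp: norm_mult norm_power abs_Re_le_cmod intro!: mult_right_mono)
    finally have 1: "(cmod c)\<^sup>2 \<le> f c + ((norm x)\<^sup>2 + 2 * cmod c * norm x)"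
      by (simp add: f_def norm_power)
    have "(4 * norm x + 1) * (2 * norm x + 1) \<le> cmod c * (cmod c - 2 * norm x)"
      using that unfolding R_def by (intro mult_mono) auto
    moreover have "2 * (norm x)\<^sup>2 < (4 * norm x + 1) * (2 * norm x + 1)"
      by (simp add: algebra_simps power2_eq_square) (intro add_pos_nonneg add_nonneg_pos; simp)
    ultimately have "2 * (norm x)\<^sup>2 < (cmod c)\<^sup>2 - 2 * cmod c * norm x"
      by (simp add: algebra_simps power2_eq_square)
    then show ?thesis using 1 by (simp add: f_def quadr_def norm_power)
  qed
  have Rpos: "R > 0" unfolding R_def by (intro add_nonneg_pos) auto
  obtain zm where zm: "zm \<in> cball 0 R" "\<And>c. c \<in> cball 0 R \<Longrightarrow> f zm \<le> f c"
    using continuous_attains_inf[OF compact_cball _ cont, of 0 R] Rpos by force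
  define m where "m = f zm"
  have min: "m \<le> f c" for c
  proof (cases "cmod c \<le> R")
    case False
    then have "f 0 < f c" using out by simp
    moreover have "m \<le> f 0" unfolding m_def using zm(2)[of 0] Rpos by simp
    ultimately show ?thesis by simp
  qed (use zm in \<open>simp add: m_def\<close>)
  define S where "S = {c \<in> cball 0 R. f c = m}"
  have "compact S"
  proof -
    have "closed {c. f c = m}"
      using cont by (intro closed_Collect_eq) auto
    then have "compact (cball 0 R \<inter> {c. f c = m})"
      by (intro compact_Int_closed compact_cball)
    moreover have "S = cball 0 R \<inter> {c. f c = m}" by (auto simp: S_def)
    ultimately show ?thesis by simp
  qed
  moreover have "S \<noteq> {}" using zm by (auto simp: S_def m_def)
  ultimately obtain z0 where z0: "z0 \<in> S" "\<And>c. c \<in> S \<Longrightarrow> cmod c \<le> cmod z0"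
    using continuous_attains_sup[of S norm] continuous_on_norm_id by blast
  have "m = 0"
  proof (rule ccontr)
    assume "m \<noteq> 0"
    then have m: "m > 0" unfolding m_def f_def by simp
    define a b where "a = Re z0" and "b = Im z0"
    \<comment> \<open>Keeping the real part and raising the squared modulus by \<open>m / 2\<close>
      gives \<open>quadr x z1 = quadr x z0 + m / 2\<close>. Being farther out than
      \<open>z0\<close>, the point \<open>z1\<close> cannot be a minimizer.\<close>
    define z1 where "z1 = Complex a (sqrt (b\<^sup>2 + m / 2))"
    have z1: "(cmod z1)\<^sup>2 = (cmod z0)\<^sup>2 + m / 2"
      using m by (simp add: z1_def a_def b_def cmod_power2)
    have big: "m < f z1"
    proof (rule ccontr)
      assume "\<not> m < f z1"
      then have *: "f z1 = m" using min[of z1] by simp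
      have "cmod z1 \<le> R"
        using out[of z1] min[of 0] * by force
      with * have "z1 \<in> S" by (simp add: S_def)
      then have "cmod z1 \<le> cmod z0" using z0 by blast
      then have "(cmod z1)\<^sup>2 \<le> (cmod z0)\<^sup>2" by (simp add: power_mono)
      with z1 m show False by simp
    qed
    \<comment> \<open>Completing the square leads from \<open>x\<close> to \<open>u\<close> by a
      real shift, a squaring and another real shift. Shifts preserve the lower bound on all
      quadratics and squaring turns \<open>m\<close> into \<open>m^2\<close>, as
      \<open>quadr_lower_powers\<close> wants it.\<close>
    define u where "u = (x + of_real (- a))\<^sup>2 + of_real (b\<^sup>2)"
    have u: "u = quadr x z0"
      by (simp add: u_def quadr_def a_def b_def cmod_power2 power2_diff algebra_simps)
    then have nu: "norm u = m" using z0(1) by (simp add: S_def f_def)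
    have u1: "norm (u - of_real (- (m / 2))) = f z1"
      unfolding f_def u quadr_def z1 by (simp add: z1_def a_def algebra_simps)
    have 1: "m \<le> norm (quadr (x + of_real (- a)) c)" for c
      using min[of "c + of_real a"] quadr_shift[of x "- a" "c + of_real a"] unfolding f_def by simp
    have 2: "m\<^sup>2 \<le> norm (quadr ((x + of_real (- a))\<^sup>2) c)" for c
      using quadr_lower_power2[OF 1] m by simp
    have 3: "m\<^sup>2 \<le> norm (quadr u c)" for c
      using 2[of "c - of_real (b\<^sup>2)"] quadr_shift[of "(x + of_real (- a))\<^sup>2" "b\<^sup>2" "c - of_real (b\<^sup>2)"]
      unfolding u_def by simp
    have le: "f z1 / m \<le> 1 + (1 / 2) ^ (2 ^ k)" for k :: nat
    proof -
      have "f z1 * m ^ (2 ^ k - 1) \<le> norm (u ^ (2 ^ k) - of_real ((- (m / 2)) ^ (2 ^ k)))"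
        using quadr_lower_powers[OF 3, of "- (m / 2)" k] m unfolding u1 by simp
      also have "\<dots> \<le> m ^ (2 ^ k) + (m / 2) ^ (2 ^ k)"
        using m by (intro order_trans[OF norm_triangle_ineq4]) (simp add: norm_power nu)
      finally have "f z1 * m ^ (2 ^ k - 1) / m ^ (2 ^ k) \<le> (m ^ (2 ^ k) + (m / 2) ^ (2 ^ k)) / m ^ (2 ^ k)"
        using m by (intro divide_right_mono) auto
      moreover have "(m / 2) ^ (2 ^ k) / m ^ (2 ^ k) = (1 / 2) ^ (2 ^ k)"
        using m by (simp flip: power_divide)
      moreover have "f z1 * m ^ (2 ^ k - 1) / m ^ (2 ^ k) = f z1 / m"
        using m power_minus_mult[of "2 ^ k" m] by (simp add: field_simps)
      ultimately show ?thesis using m by (simp add: add_divide_distrib)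
    qed
    have "filterlim (\<lambda>k. 2 ^ k :: nat) at_top sequentially"
      by (intro filterlim_subseq) (auto simp: strict_mono_def)
    then have "(\<lambda>k. (1 / 2 :: real) ^ (2 ^ k)) \<longlonglongrightarrow> 0"
      by (intro filterlim_compose[OF LIMSEQ_power_zero[of "1/2::real"]]) auto
    then have "(\<lambda>k. 1 + (1 / 2 :: real) ^ (2 ^ k)) \<longlonglongrightarrow> 1 + 0"
      by (intro tendsto_intros)
    then have "f z1 / m \<le> 1 + 0" by (rule LIMSEQ_le_const) (use le in auto)
    then show False using big m by (simp add: field_simps)
  qed
  then show ?thesis using zm by (auto simp: m_def f_def)
qed

text \<open>Applying the bound to high powers of \<open>z\<close> removes the factor 2. Then
  \<open>N z * N (cnj z)\<close> equals \<open>(cmod z)^2\<close> with both factors at most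
  \<open>cmod z\<close>, so neither can be smaller.\<close>

lemma complex_absolute_value_unique:
  fixes N :: "complex \<Rightarrow> real"
  assumes N: "\<And>z. 0 \<le> N z" "\<And>z w. N (z * w) = N z * N w" "\<And>z. N z \<le> 2 * cmod z"
    "\<And>r. N (of_real r) = \<bar>r\<bar>"
  shows "N z = cmod z"
proof -
  have N1: "N 1 = 1" using N(4)[of 1] by simp
  have pw: "N (z ^ n) = N z ^ n" for z n
    by (induction n) (auto simp: N N1)
  have le: "N z \<le> cmod z" for z
  proof (rule ccontr)
    assume a: "\<not> N z \<le> cmod z"
    then have z: "cmod z > 0" using N(3)[of z] by (cases "z = 0") auto
    then have "1 < N z / cmod z" using a by (simp add: field_simps)
    then obtain n where n: "2 < (N z / cmod z) ^ n" using real_arch_pow by blast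
    moreover have "N z ^ n \<le> 2 * cmod z ^ n" using N(3)[of "z ^ n"] pw by (simp add: norm_power)
    ultimately show False using z by (simp add: power_divide field_simps)
  qed
  have "N z * N (cnj z) = (cmod z)\<^sup>2"
    using N(4)[of "(cmod z)\<^sup>2"] by (simp flip: N(2) add: complex_norm_square[symmetric])
  moreover have "N z * N (cnj z) \<le> N z * cmod z"
    using le[of "cnj z"] N(1)[of z] by (intro mult_left_mono) auto
  ultimately have "cmod z * cmod z \<le> N z * cmod z" by (simp add: power2_eq_square)
  then show ?thesis using le[of z] N(1)[of z] by (cases "cmod z = 0") auto
qed

text \<open>If some element is not real, a root of its quadratic yields \<open>j\<close> with
  \<open>j * j = -1\<close>, and \<open>h\<close> maps the complex numbers into the field. Pulling
  the norm back along \<open>h\<close> gives a multiplicative norm, so \<open>h\<close> is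
  isometric; Ostrowski makes it surjective, and \<open>\<phi>\<close> is its inverse.\<close>

lemma isometric_embedding_complex:
  obtains \<phi> :: "'k::real_normed_field \<Rightarrow> complex"
  where "bounded_linear \<phi>" "\<And>x y. \<phi> (x * y) = \<phi> x * \<phi> y" "\<And>x. cmod (\<phi> x) = norm x"
proof (cases "\<forall>x::'k. x \<in> \<real>")
  case True
  define \<phi> :: "'k \<Rightarrow> complex" where "\<phi> x = of_real (THE r. x = of_real r)" for x
  have \<phi>: "\<phi> (of_real r) = of_real r" for r
    by (simp add: \<phi>_def)
  have ex: "\<exists>r. x = of_real r" for x :: 'k using True by (auto simp: Reals_def)
  show ?thesis
  proof (rule that)
    show "bounded_linear \<phi>"
    proof (rule bounded_linear_intro[where K = 1])
      show "\<phi> (x + y) = \<phi> x + \<phi> y" for x y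
        using ex[of x] ex[of y] \<phi> by (metis of_real_add)
      show "\<phi> (r *\<^sub>R x) = r *\<^sub>R \<phi> x" for r x
        using ex[of x] \<phi> by (metis of_real_mult scaleR_conv_of_real)
      show "cmod (\<phi> x) \<le> norm x * 1" for x
        using ex[of x] \<phi> by (metis mult.right_neutral norm_of_real order_refl)
    qed
    show "\<phi> (x * y) = \<phi> x * \<phi> y" for x y
      using ex[of x] ex[of y] \<phi> by (metis of_real_mult)
    show "cmod (\<phi> x) = norm x" for x
      using ex[of x] \<phi> by (metis norm_of_real)
  qed
next
  case False
  have sq: "\<exists>a b. (x - of_real a)\<^sup>2 = - (of_real b)\<^sup>2" for x :: 'k
  proof -
    obtain c where c: "quadr x c = 0" using ostrowski_quadratic by blast
    have "(x - of_real (Re c))\<^sup>2 = quadr x c - (of_real (Im c))\<^sup>2"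
      unfolding quadr_def by (simp add: cmod_power2 power2_diff algebra_simps)
    with c show ?thesis by auto
  qed
  obtain x :: 'k where x: "x \<notin> \<real>" using False by blast
  obtain a b where ab: "(x - of_real a)\<^sup>2 = - (of_real b)\<^sup>2" using sq by blast
  have b: "b \<noteq> 0" using x ab by auto
  define j where "j = (x - of_real a) / of_real b"
  have j: "j * j = -1" using ab b by (simp add: j_def power2_eq_square field_simps)
  define h where "h z = of_real (Re z) + of_real (Im z) * j" for z
  have h_add: "h (z + w) = h z + h w" for z w by (simp add: h_def algebra_simps)
  have h_mult: "h (z * w) = h z * h w" for z w
  proof -
    have "h z * h w = of_real (Re z) * of_real (Re w) + of_real (Im z) * of_real (Im w) * (j * j)
        + (of_real (Re z) * of_real (Im w) + of_real (Im z) * of_real (Re w)) * j"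
      by (simp add: h_def algebra_simps)
    then show ?thesis unfolding j by (simp add: h_def algebra_simps)
  qed
  have h_real: "h (of_real r) = of_real r" for r by (simp add: h_def)
  have "(norm j)\<^sup>2 = norm (j * j)" by (simp add: norm_mult power2_eq_square)
  then have nj: "norm j = 1" unfolding j
    by (metis norm_minus_cancel norm_one one_power2 power2_eq_iff_nonneg norm_ge_zero)
  have h_norm: "norm (h z) = cmod z" for z
  proof (rule complex_absolute_value_unique)
    fix z show "norm (h z) \<le> 2 * cmod z"
      unfolding h_def using abs_Re_le_cmod[of z] abs_Im_le_cmod[of z]
      by (intro order_trans[OF norm_triangle_ineq]) (simp add: norm_mult nj)
  qed (auto simp: h_mult norm_mult h_real)
  \<comment> \<open>Any \<open>y\<close>, shifted by a real number, is a square root of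
    \<open>- b^2\<close>. So is \<open>b * j\<close>, and in a field two such roots differ at most
    by sign.\<close>
  have "\<exists>z. y = h z" for y
  proof -
    obtain a b where ab: "(y - of_real a)\<^sup>2 = - (of_real b)\<^sup>2" using sq by blast
    have "(of_real b * j)\<^sup>2 = - (of_real b)\<^sup>2"
      using j by (simp add: power_mult_distrib power2_eq_square[of j])
    then have "y - of_real a = of_real b * j \<or> y - of_real a = - (of_real b * j)"
      using ab by (metis power2_eq_iff)
    then have "y = h (Complex a b) \<or> y = h (Complex a (- b))"
      by (auto simp: h_def algebra_simps)
    then show ?thesis by blast
  qed
  then obtain \<phi> where \<phi>: "\<And>y. h (\<phi> y) = y" by metis
  have h_diff: "h (z - w) = h z - h w" for z w by (simp add: h_def algebra_simps)
  have inj: "z = w" if "h z = h w" for z w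
    using h_norm[of "z - w"] that h_diff by simp
  show ?thesis
  proof (rule that)
    show n: "cmod (\<phi> x) = norm x" for x by (metis \<phi> h_norm)
    show m: "\<phi> (x * y) = \<phi> x * \<phi> y" for x y by (rule inj) (simp add: \<phi> h_mult)
    show "bounded_linear \<phi>"
    proof (rule bounded_linear_intro[where K = 1])
      show "\<phi> (x + y) = \<phi> x + \<phi> y" for x y by (rule inj) (simp add: \<phi> h_add)
      show "\<phi> (r *\<^sub>R x) = r *\<^sub>R \<phi> x" for r x
        by (rule inj) (simp add: \<phi> h_mult h_real scaleR_conv_of_real)
    qed (simp add: n)
  qed
qed

section \<open>The sequence spaces\<close>

text \<open>When one argument is zero, convexity amounts to \<open>w powr p \<le> w\<close> for
  \<open>w\<close> in the unit interval; otherwise both arguments are positive.\<close>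

lemma powr_convex_nonneg:
  fixes a b p u v :: real
  assumes "1 \<le> p" "0 \<le> a" "0 \<le> b" "0 \<le> u" "0 \<le> v" "u + v = 1"
  shows "(u * a + v * b) powr p \<le> u * a powr p + v * b powr p"
proof -
  have scale: "(w * c) powr p \<le> w * c powr p" if "0 \<le> w" "w \<le> 1" "0 \<le> c" for w c :: real
  proof -
    have "w powr p \<le> w"
      using that assms(1) powr_mono'[of 1 p w] by simp
    then show ?thesis using that by (simp add: powr_mult mult_right_mono)
  qed
  consider "a = 0" | "b = 0" | "a > 0" "b > 0" using assms by linarith
  then show ?thesis
  proof cases
    case 1
    then show ?thesis using scale[of v b] assms by simp
  next
    case 2
    then show ?thesis using scale[of u a] assms by simp
  next
    case 3
    have u: "u = 1 - v" using assms by simp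
    show ?thesis
      using convex_onD[OF powr_convex[OF assms(1)], of v a b] assms(4,5) 3 unfolding u by simp
  qed
qed

text \<open>The absolute value extends convexity to the whole line, the form in which Jensen's
  inequality is applied to the Pettis integral.\<close>

lemma convex_on_abs_powr:
  assumes "1 \<le> p"
  shows "convex_on UNIV (\<lambda>x::real. \<bar>x\<bar> powr p)"
proof (rule convex_onI)
  fix t x y :: real assume t: "0 < t" "t < 1"
  have "\<bar>(1 - t) *\<^sub>R x + t *\<^sub>R y\<bar> \<le> (1 - t) * \<bar>x\<bar> + t * \<bar>y\<bar>"
    using t abs_triangle_ineq[of "(1 - t) * x" "t * y"] by (simp add: abs_mult)
  then have "\<bar>(1 - t) *\<^sub>R x + t *\<^sub>R y\<bar> powr p \<le> ((1 - t) * \<bar>x\<bar> + t * \<bar>y\<bar>) powr p"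
    using assms by (intro powr_mono2) auto
  also have "\<dots> \<le> (1 - t) * \<bar>x\<bar> powr p + t * \<bar>y\<bar> powr p"
    using t assms by (intro powr_convex_nonneg) auto
  finally show "\<bar>(1 - t) *\<^sub>R x + t *\<^sub>R y\<bar> powr p \<le> (1 - t) * \<bar>x\<bar> powr p + t * \<bar>y\<bar> powr p" .
qed auto

definition lp_unit :: "nat \<Rightarrow> nat \<Rightarrow> 'k::real_normed_field" where
  "lp_unit a = (\<lambda>i. if i = a then 1 else 0)"

definition lp_trunc :: "nat \<Rightarrow> (nat \<Rightarrow> 'k) \<Rightarrow> nat \<Rightarrow> 'k::real_normed_field" where
  "lp_trunc N x = (\<lambda>i. if i < N then x i else 0)"

lemma lp_norm_nonneg [simp]: "0 \<le> lp_norm p x"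
  by (simp add: lp_norm_def)

locale lp_exponent =
  fixes p :: real
  assumes one_le_p: "1 \<le> p"
begin

lemma lp_norm_powr:
  assumes "x \<in> lp_space p"
  shows "lp_norm p x powr p = (\<Sum>i. norm (x i) powr p)"
proof -
  have "0 \<le> (\<Sum>i. norm (x i) powr p)"
    using assms unfolding lp_space_def by (intro suminf_nonneg) auto
  moreover have "1 / p * p = 1" using one_le_p by simp
  ultimately show ?thesis unfolding lp_norm_def powr_powr by (simp only: powr_one)
qed

lemma lp_norm_partial:
  assumes "x \<in> lp_space p" "finite I"
  shows "(\<Sum>i\<in>I. norm (x i) powr p) \<le> lp_norm p x powr p"
  using assms by (simp add: lp_norm_powr lp_space_def sum_le_suminf)

lemma lp_normI:
  assumes "\<And>N. (\<Sum>i<N. norm (x i) powr p) \<le> C powr p" "0 \<le> C"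
  shows "x \<in> lp_space p" "lp_norm p x \<le> C"
proof -
  show s: "x \<in> lp_space p"
    unfolding lp_space_def using assms(1)
    by (auto intro!: summableI_nonneg_bounded[where x = "C powr p"])
  have "(\<Sum>i. norm (x i) powr p) \<le> C powr p"
    using s assms by (intro suminf_le_const) (auto simp: lp_space_def)
  then have "lp_norm p x powr p \<le> C powr p" using lp_norm_powr[OF s] by simp
  then show "lp_norm p x \<le> C"
    using one_le_p assms(2) powr_less_mono2[of p C "lp_norm p x"] by (cases "lp_norm p x \<le> C") auto
qed

lemma lp_norm_coord:
  assumes "x \<in> lp_space p"
  shows "norm (x i) \<le> lp_norm p x"
proof -
  have "norm (x i) powr p \<le> lp_norm p x powr p"
    using lp_norm_partial[OF assms, of "{i}"] by simp
  then show ?thesis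
    using one_le_p powr_less_mono2[of p "lp_norm p x" "norm (x i)"] by (cases "norm (x i) \<le> lp_norm p x") auto
qed

lemma lp_norm_mono:
  assumes "y \<in> lp_space p" "\<And>i. norm (x i) \<le> norm (y i)"
  shows "x \<in> lp_space p" "lp_norm p x \<le> lp_norm p y"
proof -
  have *: "(\<Sum>i<N. norm (x i) powr p) \<le> lp_norm p y powr p" for N
  proof -
    have "(\<Sum>i<N. norm (x i) powr p) \<le> (\<Sum>i<N. norm (y i) powr p)"
      using one_le_p assms(2) by (intro sum_mono powr_mono2) auto
    also have "\<dots> \<le> lp_norm p y powr p" using assms by (intro lp_norm_partial) auto
    finally show ?thesis .
  qed
  show "x \<in> lp_space p" "lp_norm p x \<le> lp_norm p y"
    using lp_normI[OF *] by auto
qed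

text \<open>Fatou's lemma for sequences: coordinatewise convergence is enough, since each finite
  partial sum passes to the limit.\<close>

lemma lp_fatou:
  assumes "\<And>N. X N \<in> lp_space p" "\<And>N. lp_norm p (X N) \<le> C" "\<And>i. (\<lambda>N. X N i) \<longlonglongrightarrow> x i"
  shows "x \<in> lp_space p" "lp_norm p x \<le> C"
proof -
  have C: "0 \<le> C" using assms(2)[of 0] lp_norm_nonneg order_trans by blast
  have *: "(\<Sum>i<n. norm (x i) powr p) \<le> C powr p" for n
  proof (rule LIMSEQ_le_const2)
    show "(\<lambda>N. \<Sum>i<n. norm (X N i) powr p) \<longlonglongrightarrow> (\<Sum>i<n. norm (x i) powr p)"
      using one_le_p by (intro tendsto_intros tendsto_powr2 assms(3)) auto
    have "(\<Sum>i<n. norm (X N i) powr p) \<le> C powr p" for N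
      using one_le_p lp_norm_partial[OF assms(1)[of N], of "{..<n}"] assms(2)[of N]
        powr_mono2[of p "lp_norm p (X N)" C] by simp
    then show "\<exists>N0. \<forall>N\<ge>N0. (\<Sum>i<n. norm (X N i) powr p) \<le> C powr p" by blast
  qed
  show "x \<in> lp_space p" "lp_norm p x \<le> C" using lp_normI[OF * C] by auto
qed

lemma lp_zero [simp]: "(\<lambda>i. 0) \<in> lp_space p" "lp_norm p (\<lambda>i. 0) = 0"
  by (auto simp: lp_space_def lp_norm_def)

lemma lp_norm_eq_0:
  assumes "x \<in> lp_space p" "lp_norm p x = 0"
  shows "x = (\<lambda>i. 0)"
  using lp_norm_coord[OF assms(1)] assms(2) by (intro ext) simp

lemma lp_scale:
  assumes "x \<in> lp_space p"
  shows "(\<lambda>i. c * x i) \<in> lp_space p" "lp_norm p (\<lambda>i. c * x i) = norm c * lp_norm p x"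
proof -
  have s: "summable (\<lambda>i. norm (x i) powr p)" using assms by (simp add: lp_space_def)
  have e: "norm (c * x i) powr p = norm c powr p * norm (x i) powr p" for i
    by (simp add: norm_mult powr_mult)
  show "(\<lambda>i. c * x i) \<in> lp_space p"
    unfolding lp_space_def mem_Collect_eq e using s by (rule summable_mult)
  have "0 \<le> (\<Sum>i. norm (x i) powr p)" using s by (simp add: suminf_nonneg)
  then show "lp_norm p (\<lambda>i. c * x i) = norm c * lp_norm p x"
    unfolding lp_norm_def e suminf_mult[OF s]
    using one_le_p by (simp add: powr_mult powr_powr)
qed

text \<open>Minkowski's inequality by convexity. With \<open>s = ?a + ?b\<close>, the sum is
  \<open>s\<close> times the convex combination, with weights \<open>?a / s\<close> and
  \<open>?b / s\<close>, of the normalized vectors \<open>x / ?a\<close> and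
  \<open>y / ?b\<close>.\<close>

lemma lp_add:
  assumes x: "x \<in> lp_space p" and y: "y \<in> lp_space p"
  shows "(\<lambda>i. x i + y i) \<in> lp_space p"
    "lp_norm p (\<lambda>i. x i + y i) \<le> lp_norm p x + lp_norm p y"
proof -
  let ?a = "lp_norm p x" and ?b = "lp_norm p y"
  have *: "(\<Sum>i<N. norm (x i + y i) powr p) \<le> (?a + ?b) powr p" for N
  proof (cases "?a = 0 \<or> ?b = 0")
    case True
    then have "x = (\<lambda>i. 0) \<or> y = (\<lambda>i. 0)" using x y lp_norm_eq_0 by blast
    then show ?thesis using x y by (auto intro!: lp_norm_partial)
  next
    case False
    then have ab: "?a > 0" "?b > 0" using lp_norm_nonneg less_eq_real_def by metis+
    let ?s = "?a + ?b"
    have pt: "norm (x i + y i) powr p \<le>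
        ?s powr p * (?a / ?s * (norm (x i) powr p / ?a powr p) + ?b / ?s * (norm (y i) powr p / ?b powr p))" for i
    proof -
      have "norm (x i + y i) \<le> norm (x i) + norm (y i)" by (rule norm_triangle_ineq)
      also have "\<dots> = ?s * (?a / ?s * (norm (x i) / ?a) + ?b / ?s * (norm (y i) / ?b))"
      proof -
        have "?s * (?a / ?s * u) = ?a * u" "?s * (?b / ?s * u) = ?b * u" for u using ab by auto
        then show ?thesis using ab by (simp add: distrib_left)
      qed
      finally have "norm (x i + y i) powr p \<le> (?s * (?a / ?s * (norm (x i) / ?a) + ?b / ?s * (norm (y i) / ?b))) powr p"
        using one_le_p by (intro powr_mono2) auto
      also have "\<dots> = ?s powr p * (?a / ?s * (norm (x i) / ?a) + ?b / ?s * (norm (y i) / ?b)) powr p"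
        using ab by (intro powr_mult)
      also have "\<dots> \<le> ?s powr p * (?a / ?s * (norm (x i) / ?a) powr p + ?b / ?s * (norm (y i) / ?b) powr p)"
        using ab one_le_p by (intro mult_left_mono powr_convex_nonneg) (auto simp flip: add_divide_distrib)
      finally show ?thesis using ab by (simp add: powr_divide)
    qed
    have "(\<Sum>i<N. norm (x i + y i) powr p) \<le> (\<Sum>i<N. ?s powr p * (?a / ?s * (norm (x i) powr p / ?a powr p) + ?b / ?s * (norm (y i) powr p / ?b powr p)))"
      by (intro sum_mono pt)
    also have "\<dots> = ?s powr p * (?a / ?s * ((\<Sum>i<N. norm (x i) powr p) / ?a powr p) + ?b / ?s * ((\<Sum>i<N. norm (y i) powr p) / ?b powr p))"
      by (simp only: sum_distrib_left[symmetric] sum_divide_distrib[symmetric] sum.distrib)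
    also have "\<dots> \<le> ?s powr p * (?a / ?s * 1 + ?b / ?s * 1)"
      using ab lp_norm_partial[OF x, of "{..<N}"] lp_norm_partial[OF y, of "{..<N}"]
      by (intro mult_left_mono add_mono) auto
    also have "\<dots> = ?s powr p" using ab by (simp flip: add_divide_distrib)
    finally show ?thesis .
  qed
  show "(\<lambda>i. x i + y i) \<in> lp_space p"
    "lp_norm p (\<lambda>i. x i + y i) \<le> lp_norm p x + lp_norm p y"
    using lp_normI[OF *] by auto
qed

lemma lp_diff:
  assumes x: "x \<in> lp_space p" and y: "y \<in> lp_space p"
  shows "(\<lambda>i. x i - y i) \<in> lp_space p"
    "lp_norm p (\<lambda>i. x i - y i) \<le> lp_norm p x + lp_norm p y"
  using lp_add[OF x lp_scale(1)[OF y, of "-1"]] lp_scale(2)[OF y, of "-1"] by auto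

lemma lp_norm_minus: "lp_norm p (\<lambda>i. x i - y i) = lp_norm p (\<lambda>i. y i - x i)"
  by (simp add: lp_norm_def norm_minus_commute)

lemma lp_sum:
  assumes "\<And>k. k \<in> K \<Longrightarrow> X k \<in> lp_space p"
  shows "(\<lambda>i. \<Sum>k\<in>K. X k i) \<in> lp_space p"
    "lp_norm p (\<lambda>i. \<Sum>k\<in>K. X k i) \<le> (\<Sum>k\<in>K. lp_norm p (X k))"
proof -
  have "(\<lambda>i. \<Sum>k\<in>K. X k i) \<in> lp_space p \<and> lp_norm p (\<lambda>i. \<Sum>k\<in>K. X k i) \<le> (\<Sum>k\<in>K. lp_norm p (X k))"
    using assms
  proof (induction K rule: infinite_finite_induct)
    case (insert k K)
    then have IH: "(\<lambda>i. \<Sum>k\<in>K. X k i) \<in> lp_space p"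
        "lp_norm p (\<lambda>i. \<Sum>k\<in>K. X k i) \<le> (\<Sum>k\<in>K. lp_norm p (X k))" and k: "X k \<in> lp_space p" by auto
    show ?case using lp_add[OF k IH(1)] IH(2) insert.hyps by simp
  qed auto
  then show "(\<lambda>i. \<Sum>k\<in>K. X k i) \<in> lp_space p"
    "lp_norm p (\<lambda>i. \<Sum>k\<in>K. X k i) \<le> (\<Sum>k\<in>K. lp_norm p (X k))" by auto
qed

text \<open>Completeness in the form used here: a series with summable norms is summed
  coordinatewise, and \<open>lp_fatou\<close> turns bounds on finite blocks into the bound on the
  tail.\<close>

lemma lp_suminf:
  fixes X :: "nat \<Rightarrow> nat \<Rightarrow> 'k::{real_normed_field,banach}"
  assumes X: "\<And>k. X k \<in> lp_space p" "\<And>k. lp_norm p (X k) \<le> c k" and c: "summable c"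
  shows "(\<lambda>k. X k i) sums (\<Sum>k. X k i)"
    "(\<lambda>i. \<Sum>k. X k i) \<in> lp_space p"
    "lp_norm p (\<lambda>i. (\<Sum>k. X k i) - (\<Sum>k<N. X k i)) \<le> (\<Sum>k. c (k + N))"
proof -
  have c0: "0 \<le> c k" for k using X(2)[of k] lp_norm_nonneg order_trans by blast
  have "norm (X k i) \<le> c k" for k i using lp_norm_coord[OF X(1), of k i] X(2)[of k] by simp
  then have s: "summable (\<lambda>k. X k i)" for i
    by (intro summable_comparison_test[OF _ c]) blast
  then show "(\<lambda>k. X k i) sums (\<Sum>k. X k i)" by blast
  have tail: "(\<lambda>i. \<Sum>k. X (k + N) i) \<in> lp_space p" "lp_norm p (\<lambda>i. \<Sum>k. X (k + N) i) \<le> (\<Sum>k. c (k + N))" for N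
  proof -
    have cN: "summable (\<lambda>k. c (k + N))" using c by (simp add: summable_iff_shift)
    have 1: "(\<lambda>i. \<Sum>k<n. X (k + N) i) \<in> lp_space p" for n using X by (intro lp_sum) auto
    have 2: "lp_norm p (\<lambda>i. \<Sum>k<n. X (k + N) i) \<le> (\<Sum>k. c (k + N))" for n
    proof -
      have "lp_norm p (\<lambda>i. \<Sum>k<n. X (k + N) i) \<le> (\<Sum>k<n. lp_norm p (X (k + N)))"
        using X by (intro lp_sum) auto
      also have "\<dots> \<le> (\<Sum>k<n. c (k + N))" using X by (intro sum_mono) auto
      also have "\<dots> \<le> (\<Sum>k. c (k + N))" using cN c0 by (intro sum_le_suminf) auto
      finally show ?thesis .
    qed
    have 3: "(\<lambda>n. \<Sum>k<n. X (k + N) i) \<longlonglongrightarrow> (\<Sum>k. X (k + N) i)" for i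
      by (rule summable_LIMSEQ[OF summable_ignore_initial_segment[OF s[of i]]])
    show "(\<lambda>i. \<Sum>k. X (k + N) i) \<in> lp_space p" "lp_norm p (\<lambda>i. \<Sum>k. X (k + N) i) \<le> (\<Sum>k. c (k + N))"
      using lp_fatou[OF 1 2 3] by auto
  qed
  show "(\<lambda>i. \<Sum>k. X k i) \<in> lp_space p" using tail(1)[of 0] by simp
  have "(\<Sum>k. X k i) - (\<Sum>k<N. X k i) = (\<Sum>k. X (k + N) i)" for i
    using suminf_minus_initial_segment[OF s[of i], of N] by simp
  then show "lp_norm p (\<lambda>i. (\<Sum>k. X k i) - (\<Sum>k<N. X k i)) \<le> (\<Sum>k. c (k + N))"
    using tail(2)[of N] by simp
qed

lemma lp_trunc:
  assumes "x \<in> lp_space p"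
  shows "lp_trunc N x \<in> lp_space p" "lp_norm p (lp_trunc N x) \<le> lp_norm p x"
  using lp_norm_mono[OF assms, of "lp_trunc N x"] by (auto simp: lp_trunc_def)

lemma lp_unit: "lp_unit a \<in> lp_space p"
proof -
  have "(\<lambda>i. norm (lp_unit a i :: 'a) powr p) = (\<lambda>i. if i = a then 1 else 0)"
    by (auto simp: lp_unit_def)
  then show ?thesis by (simp add: lp_space_def)
qed

lemma lp_trunc_tendsto:
  assumes "x \<in> lp_space p"
  shows "(\<lambda>N. lp_norm p (\<lambda>i. x i - lp_trunc N x i)) \<longlonglongrightarrow> 0"
proof -
  let ?f = "\<lambda>i. norm (x i) powr p"
  have s: "summable ?f" using assms by (simp add: lp_space_def)
  have e: "lp_norm p (\<lambda>i. x i - lp_trunc N x i) = (\<Sum>i. ?f (i + N)) powr (1 / p)" for N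
  proof -
    have "(\<lambda>i. norm (x i - lp_trunc N x i) powr p) = (\<lambda>i. if i < N then 0 else ?f i)"
      by (auto simp: lp_trunc_def)
    moreover have "(\<lambda>i. if i < N then 0 else ?f i) sums (\<Sum>i. ?f (i + N))"
    proof -
      have "(\<lambda>i. ?f (i + N)) sums (\<Sum>i. ?f (i + N))" using summable_ignore_initial_segment[OF s] by (rule summable_sums)
      then show ?thesis
        using sums_iff_shift[of "\<lambda>i. if i < N then 0 else ?f i" N "\<Sum>i. ?f (i + N)"] by simp
    qed
    ultimately show ?thesis unfolding lp_norm_def by (simp add: sums_iff)
  qed
  have "(\<lambda>N. (\<Sum>i. ?f i) - (\<Sum>i<N. ?f i)) \<longlonglongrightarrow> (\<Sum>i. ?f i) - (\<Sum>i. ?f i)"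
    using s by (intro tendsto_intros summable_LIMSEQ)
  then have "(\<lambda>N. \<Sum>i. ?f (i + N)) \<longlonglongrightarrow> 0"
    using suminf_minus_initial_segment[OF s] by simp
  then have "(\<lambda>N. (\<Sum>i. ?f (i + N)) powr (1 / p)) \<longlonglongrightarrow> 0 powr (1 / p)"
    using one_le_p s by (intro tendsto_powr2 tendsto_intros)
      (auto intro!: always_eventually suminf_nonneg summable_ignore_initial_segment[of ?f])
  then show ?thesis unfolding e by simp
qed

lemma lp_trunc_eq_sum: "lp_trunc N x = (\<lambda>i. \<Sum>a<N. x a * lp_unit a i)"
proof
  fix i
  have "(\<Sum>a<N. x a * lp_unit a i) = (\<Sum>a<N. if i = a then x a else 0)"
    by (intro sum.cong) (auto simp: lp_unit_def)
  then show "lp_trunc N x i = (\<Sum>a<N. x a * lp_unit a i)" by (simp add: lp_trunc_def)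
qed

text \<open>Split off \<open>2 - p\<close> powers of each coordinate and bound them by the norm:
  \<open>norm (x i) powr 2 \<le> norm (x i) powr p * ?s powr (2 - p)\<close>.\<close>

lemma l2_le_lp:
  assumes "p \<le> 2" "x \<in> lp_space p"
  shows "x \<in> lp_space 2" "lp_norm 2 x \<le> lp_norm p x"
proof -
  let ?s = "lp_norm p x"
  interpret l2: lp_exponent 2 by unfold_locales simp
  have *: "(\<Sum>i<N. norm (x i) powr 2) \<le> ?s powr 2" for N
  proof -
    have "norm (x i) powr 2 \<le> norm (x i) powr p * ?s powr (2 - p)" for i
    proof -
      have "norm (x i) powr 2 = norm (x i) powr p * norm (x i) powr (2 - p)"
        by (simp flip: powr_add)
      also have "\<dots> \<le> norm (x i) powr p * ?s powr (2 - p)"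
        using assms lp_norm_coord[of x i] by (intro mult_left_mono powr_mono2) auto
      finally show ?thesis .
    qed
    then have "(\<Sum>i<N. norm (x i) powr 2) \<le> (\<Sum>i<N. norm (x i) powr p) * ?s powr (2 - p)"
      unfolding sum_distrib_right by (intro sum_mono)
    also have "\<dots> \<le> ?s powr p * ?s powr (2 - p)"
      using lp_norm_partial[OF assms(2), of "{..<N}"] by (intro mult_right_mono) auto
    also have "\<dots> = ?s powr 2" by (simp flip: powr_add)
    finally show ?thesis .
  qed
  show "x \<in> lp_space 2" "lp_norm 2 x \<le> lp_norm p x" using l2.lp_normI[OF *] by auto
qed

end

section \<open>Operators and their exponentials\<close>

fun word_op :: "(nat \<Rightarrow> (nat \<Rightarrow> 'k) \<Rightarrow> (nat \<Rightarrow> 'k)) \<Rightarrow> nat list \<Rightarrow> (nat \<Rightarrow> 'k) \<Rightarrow> (nat \<Rightarrow> 'k)" where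
  "word_op Bs [] x = x"
| "word_op Bs (i # w) x = Bs i (word_op Bs w x)"

context lp_exponent begin

lemma lp_op_space: "lp_op p L \<Longrightarrow> x \<in> lp_space p \<Longrightarrow> L x \<in> lp_space p"
  by (simp add: lp_op_def)

lemma lp_op_add:
  "lp_op p L \<Longrightarrow> x \<in> lp_space p \<Longrightarrow> y \<in> lp_space p \<Longrightarrow> L (\<lambda>i. x i + y i) = (\<lambda>i. L x i + L y i)"
  by (simp add: lp_op_def)

lemma lp_op_scale:
  "lp_op p L \<Longrightarrow> x \<in> lp_space p \<Longrightarrow> L (\<lambda>i. c * x i) = (\<lambda>i. c * L x i)"
  by (simp add: lp_op_def)

lemma lp_op_diff:
  assumes "lp_op p L" "x \<in> lp_space p" "y \<in> lp_space p"
  shows "L (\<lambda>i. x i - y i) = (\<lambda>i. L x i - L y i)"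
  using lp_op_add[OF assms(1,2) lp_scale(1)[OF assms(3), of "-1"]] lp_op_scale[OF assms(1,3), of "-1"]
  by simp

lemma lp_op_zero:
  assumes "lp_op p L"
  shows "L (\<lambda>i. 0) = (\<lambda>i. 0)"
  using lp_op_scale[OF assms lp_zero(1), of 0] by simp

lemma lp_op_sum:
  assumes "lp_op p L" "\<And>k. k \<in> K \<Longrightarrow> X k \<in> lp_space p"
  shows "L (\<lambda>i. \<Sum>k\<in>K. c k * X k i) = (\<lambda>i. \<Sum>k\<in>K. c k * L (X k) i)"
  using assms(2)
proof (induction K rule: infinite_finite_induct)
  case (insert k K)
  have 1: "(\<lambda>i. c k * X k i) \<in> lp_space p" using insert by (intro lp_scale) auto
  have 2: "(\<lambda>i. \<Sum>k\<in>K. c k * X k i) \<in> lp_space p" using insert by (intro lp_sum lp_scale) auto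
  show ?case
    using lp_op_add[OF assms(1) 1 2] lp_op_scale[OF assms(1), of "X k" "c k"] insert by simp
qed (use lp_op_zero[OF assms(1)] in auto)

lemma lp_op_bound:
  assumes "lp_op p L"
  obtains C where "0 \<le> C" "\<And>x. x \<in> lp_space p \<Longrightarrow> lp_norm p (L x) \<le> C * lp_norm p x"
proof -
  obtain C where C: "\<And>x. x \<in> lp_space p \<Longrightarrow> lp_norm p (L x) \<le> C * lp_norm p x"
    using assms unfolding lp_op_def by blast
  have "lp_norm p (L x) \<le> max C 0 * lp_norm p x" if "x \<in> lp_space p" for x
    by (rule order_trans[OF C[OF that]]) (simp add: mult_right_mono)
  then show thesis using that[of "max C 0"] by simp
qed

lemma lp_op_trunc:
  assumes "lp_op p L" "x \<in> lp_space p"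
  shows "L (lp_trunc N x) = (\<lambda>j. \<Sum>a<N. x a * L (lp_unit a) j)"
  unfolding lp_trunc_eq_sum by (rule lp_op_sum[OF assms(1) lp_unit])

text \<open>Truncations converge in norm, so a bounded operator is determined by its matrix entries
  \<open>L (lp_unit a) j\<close>. This allows a random operator applied to a random vector to be
  treated entry by entry.\<close>

lemma lp_op_coord_tendsto:
  assumes "lp_op p L" "x \<in> lp_space p"
  shows "(\<lambda>N. \<Sum>a<N. x a * L (lp_unit a) j) \<longlonglongrightarrow> L x j"
proof -
  obtain C where C: "0 \<le> C" "\<And>x. x \<in> lp_space p \<Longrightarrow> lp_norm p (L x) \<le> C * lp_norm p x"
    using lp_op_bound[OF assms(1)] by blast
  let ?d = "\<lambda>N i. x i - lp_trunc N x i"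
  have d: "?d N \<in> lp_space p" for N using assms lp_trunc by (intro lp_diff) auto
  have "norm ((\<Sum>a<N. x a * L (lp_unit a) j) - L x j) \<le> C * lp_norm p (?d N)" for N
  proof -
    have "norm ((\<Sum>a<N. x a * L (lp_unit a) j) - L x j) = norm (L (?d N) j)"
      unfolding lp_op_diff[OF assms(1,2) lp_trunc(1)[OF assms(2)]]
      using lp_op_trunc[OF assms, of N] by (simp add: norm_minus_commute)
    also have "\<dots> \<le> lp_norm p (L (?d N))" by (rule lp_norm_coord[OF lp_op_space[OF assms(1) d]])
    also have "\<dots> \<le> C * lp_norm p (?d N)" using C d by blast
    finally show ?thesis .
  qed
  moreover have "(\<lambda>N. C * lp_norm p (?d N)) \<longlonglongrightarrow> 0"
    using lp_trunc_tendsto[OF assms(2)] by (rule tendsto_mult_right_zero)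
  ultimately have "(\<lambda>N. (\<Sum>a<N. x a * L (lp_unit a) j) - L x j) \<longlonglongrightarrow> 0"
    by (intro Lim_null_comparison[where f = "\<lambda>N. (\<Sum>a<N. x a * L (lp_unit a) j) - L x j"]
        always_eventually) auto
  then show ?thesis by (simp flip: Lim_null)
qed

text \<open>Partial sums of the matrix expansion are values at truncations of \<open>x\<close>,
  hence bounded uniformly in \<open>N\<close>; this provides the dominating constant when
  expectations pass through the expansion.\<close>

lemma lp_op_partial_bound:
  assumes "lp_op p L" "x \<in> lp_space p" "0 \<le> C"
    "\<And>x. x \<in> lp_space p \<Longrightarrow> lp_norm p (L x) \<le> C * lp_norm p x"
  shows "norm (\<Sum>a<N. x a * L (lp_unit a) j) \<le> C * lp_norm p x"
proof -
  have "norm (\<Sum>a<N. x a * L (lp_unit a) j) = norm (L (lp_trunc N x) j)"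
    using lp_op_trunc[OF assms(1,2)] by simp
  also have "\<dots> \<le> lp_norm p (L (lp_trunc N x))"
    by (rule lp_norm_coord[OF lp_op_space[OF assms(1) lp_trunc(1)[OF assms(2)]]])
  also have "\<dots> \<le> C * lp_norm p (lp_trunc N x)" using assms lp_trunc by blast
  also have "\<dots> \<le> C * lp_norm p x" using assms lp_trunc by (intro mult_left_mono) auto
  finally show ?thesis .
qed

lemma lp_op_funpow:
  assumes "lp_op p L" "x \<in> lp_space p" "0 \<le> C"
    "\<And>x. x \<in> lp_space p \<Longrightarrow> lp_norm p (L x) \<le> C * lp_norm p x"
  shows "(L ^^ k) x \<in> lp_space p" "lp_norm p ((L ^^ k) x) \<le> C ^ k * lp_norm p x"
proof -
  have "(L ^^ k) x \<in> lp_space p \<and> lp_norm p ((L ^^ k) x) \<le> C ^ k * lp_norm p x"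
  proof (induction k)
    case (Suc k)
    have "lp_norm p (L ((L ^^ k) x)) \<le> C * lp_norm p ((L ^^ k) x)" using Suc assms by blast
    also have "\<dots> \<le> C * (C ^ k * lp_norm p x)" using Suc assms by (intro mult_left_mono) auto
    finally show ?case using lp_op_space[OF assms(1), of "(L ^^ k) x"] Suc by simp
  qed (use assms in auto)
  then show "(L ^^ k) x \<in> lp_space p" "lp_norm p ((L ^^ k) x) \<le> C ^ k * lp_norm p x" by auto
qed

text \<open>Absolute convergence gives a limit, and coordinates show that it is the only one, which
  resolves the definite description. The remainder bound is used with \<open>N = 0\<close> as a norm
  bound, with \<open>N = 2\<close> as the error of linearization, and with \<open>N = K\<close> for
  the limit semigroup.\<close>

lemma op_exp:
  fixes B :: "(nat \<Rightarrow> 'k::{real_normed_field,banach}) \<Rightarrow> (nat \<Rightarrow> 'k)"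
  assumes B: "lp_op p B" "x \<in> lp_space p" "0 \<le> C"
    "\<And>x. x \<in> lp_space p \<Longrightarrow> lp_norm p (B x) \<le> C * lp_norm p x" and t: "0 \<le> t"
  shows "op_exp p B t x \<in> lp_space p"
    "lp_norm p (\<lambda>i. op_exp p B t x i - (\<Sum>k<N. of_real (t ^ k / fact k) * (B ^^ k) x i))
       \<le> (exp (C * t) - (\<Sum>k<N. (C * t) ^ k / fact k)) * lp_norm p x"
proof -
  define X where "X k = (\<lambda>i. of_real (t ^ k / fact k) * (B ^^ k) x i)" for k
  define c where "c k = (C * t) ^ k / fact k * lp_norm p x" for k
  have X: "X k \<in> lp_space p" for k
    unfolding X_def using lp_op_funpow[OF B] by (intro lp_scale)
  have Xc: "lp_norm p (X k) \<le> c k" for k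
  proof -
    have "lp_norm p (X k) = t ^ k / fact k * lp_norm p ((B ^^ k) x)"
      unfolding X_def using lp_op_funpow[OF B] t by (subst lp_scale) (auto simp: norm_power norm_divide)
    also have "\<dots> \<le> t ^ k / fact k * (C ^ k * lp_norm p x)"
      using lp_op_funpow[OF B] t by (intro mult_left_mono) auto
    finally show ?thesis by (simp add: c_def power_mult_distrib mult_ac)
  qed
  have e: "(\<lambda>k. (C * t) ^ k / fact k) sums exp (C * t)"
    using exp_converges[of "C * t"] by (simp add: field_simps)
  then have cs: "c sums (exp (C * t) * lp_norm p x)"
    unfolding c_def by (rule sums_mult2)
  have tail: "(\<Sum>k. c (k + N)) = (exp (C * t) - (\<Sum>k<N. (C * t) ^ k / fact k)) * lp_norm p x" for N
  proof -
    have "(\<Sum>k. c (k + N)) = exp (C * t) * lp_norm p x - (\<Sum>k<N. c k)"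
      using suminf_minus_initial_segment[OF sums_summable[OF cs], of N] cs by (simp add: sums_iff)
    also have "(\<Sum>k<N. c k) = (\<Sum>k<N. (C * t) ^ k / fact k) * lp_norm p x"
      unfolding c_def sum_distrib_right ..
    finally show ?thesis by (simp only: left_diff_distrib)
  qed
  define y where "y = (\<lambda>i. \<Sum>k. X k i)"
  note S = lp_suminf[OF X Xc sums_summable[OF cs], folded y_def, unfolded tail]
  have y: "lp_norm p (\<lambda>i. y i - (\<Sum>k<N. X k i)) \<le> (exp (C * t) - (\<Sum>k<N. (C * t) ^ k / fact k)) * lp_norm p x" for N
    using S(3)[of N] unfolding y_def .
  have lim: "(\<lambda>N. lp_norm p (\<lambda>i. (\<Sum>k<N. X k i) - y i)) \<longlonglongrightarrow> 0"
  proof (rule tendsto_sandwich[OF _ _ tendsto_const])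
    have "(\<lambda>N. (exp (C * t) - (\<Sum>k<N. (C * t) ^ k / fact k)) * lp_norm p x) \<longlonglongrightarrow> (exp (C * t) - exp (C * t)) * lp_norm p x"
      using e unfolding sums_def by (intro tendsto_intros)
    then show "(\<lambda>N. (exp (C * t) - (\<Sum>k<N. (C * t) ^ k / fact k)) * lp_norm p x) \<longlonglongrightarrow> 0" by simp
    show "\<forall>\<^sub>F N in sequentially. lp_norm p (\<lambda>i. (\<Sum>k<N. X k i) - y i)
       \<le> (exp (C * t) - (\<Sum>k<N. (C * t) ^ k / fact k)) * lp_norm p x"
      using y by (subst lp_norm_minus) simp
  qed simp
  have uniq: "z = y" if z: "z \<in> lp_space p" "(\<lambda>N. lp_norm p (\<lambda>i. (\<Sum>k<N. X k i) - z i)) \<longlonglongrightarrow> 0" for z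
  proof
    fix i
    have coord: "(\<lambda>N. \<Sum>k<N. X k i) \<longlonglongrightarrow> w i"
      if w: "w \<in> lp_space p" "(\<lambda>N. lp_norm p (\<lambda>i. (\<Sum>k<N. X k i) - w i)) \<longlonglongrightarrow> 0" for w
    proof -
      have "(\<lambda>i. (\<Sum>k<N. X k i) - w i) \<in> lp_space p" for N using w X by (intro lp_diff lp_sum)
      then have "norm ((\<Sum>k<N. X k i) - w i) \<le> lp_norm p (\<lambda>i. (\<Sum>k<N. X k i) - w i)" for N
        using lp_norm_coord[where x = "\<lambda>i. (\<Sum>k<N. X k i) - w i"] by blast
      then have "(\<lambda>N. (\<Sum>k<N. X k i) - w i) \<longlonglongrightarrow> 0"
        by (intro Lim_null_comparison[OF _ w(2)] always_eventually) auto
      then show ?thesis by (simp flip: Lim_null)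
    qed
    show "z i = y i" using LIMSEQ_unique[OF coord[OF z] coord] S(2) lim by (simp add: y_def)
  qed
  have "op_exp p B t x = y"
    unfolding op_exp_def
  proof (rule the_equality)
    show "y \<in> lp_space p \<and> (\<lambda>N. lp_norm p (\<lambda>i. (\<Sum>k<N. of_real (t ^ k / fact k) * (B ^^ k) x i) - y i)) \<longlonglongrightarrow> 0"
      using S(2) lim by (simp add: y_def X_def)
  qed (use uniq in \<open>simp add: X_def\<close>)
  then show "op_exp p B t x \<in> lp_space p"
    "lp_norm p (\<lambda>i. op_exp p B t x i - (\<Sum>k<N. of_real (t ^ k / fact k) * (B ^^ k) x i))
       \<le> (exp (C * t) - (\<Sum>k<N. (C * t) ^ k / fact k)) * lp_norm p x"
    using S(2) y[of N] by (simp_all add: y_def X_def)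
qed

section \<open>Products along words and the linearized product\<close>

lemma word_op_lp:
  assumes "\<And>i. lp_op p (Bs i)" "x \<in> lp_space p"
  shows "word_op Bs w x \<in> lp_space p"
  using assms(2) lp_op_space[OF assms(1)] by (induction w) simp_all

lemma word_op_bound:
  assumes "\<And>i. lp_op p (Bs i)" "x \<in> lp_space p" "0 \<le> C"
    "\<And>i x. x \<in> lp_space p \<Longrightarrow> lp_norm p (Bs i x) \<le> C * lp_norm p x"
  shows "lp_norm p (word_op Bs w x) \<le> C ^ length w * lp_norm p x"
proof (induction w)
  case (Cons i w)
  have "lp_norm p (Bs i (word_op Bs w x)) \<le> C * lp_norm p (word_op Bs w x)"
    using word_op_lp[where Bs = Bs] assms by blast
  also have "\<dots> \<le> C * (C ^ length w * lp_norm p x)" using Cons assms by (intro mult_left_mono) auto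
  finally show ?case by simp
qed simp

text \<open>Each factor contributes either the identity or \<open>s * Bs i\<close>, and
  \<open>List.subseqs (i # l)\<close> branches in the same way: words without and with the letter
  \<open>i\<close>.\<close>

lemma lin_product_expand:
  assumes "\<And>i. lp_op p (Bs i)" "x \<in> lp_space p"
  shows "foldr (\<lambda>i y j. y j + s * Bs i y j) l x = (\<lambda>j. \<Sum>w\<leftarrow>List.subseqs l. s ^ length w * word_op Bs w x j)"
proof (induction l)
  case (Cons i l)
  \<comment> \<open>Membership in the space is proved along with the equation because additivity of
    \<open>Bs i\<close> is available on \<open>lp_space p\<close> only.\<close>
  have L: "Bs i (\<lambda>j. \<Sum>w\<leftarrow>W. s ^ length w * word_op Bs w x j)
    = (\<lambda>j. \<Sum>w\<leftarrow>W. s ^ length w * Bs i (word_op Bs w x) j) \<and>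
    (\<lambda>j. \<Sum>w\<leftarrow>W. s ^ length w * word_op Bs w x j) \<in> lp_space p" for W
  proof (induction W)
    case (Cons w W)
    have w: "word_op Bs w x \<in> lp_space p" using word_op_lp[where Bs = Bs] assms by blast
    have sw: "(\<lambda>j. s ^ length w * word_op Bs w x j) \<in> lp_space p" using w by (rule lp_scale)
    show ?case
      using lp_op_add[OF assms(1) sw conjunct2[OF Cons], of i] lp_op_scale[OF assms(1) w, of i "s ^ length w"] Cons
        lp_add[OF sw conjunct2[OF Cons]] by simp
  qed (use lp_op_zero assms in auto)
  show ?case
    unfolding foldr_Cons comp_def Cons conjunct1[OF L]
    by (rule ext) (simp add: Let_def comp_def sum_list_const_mult mult.assoc)
qed simp

text \<open>From \<open>1 - h \<le> exp (- h)\<close> follows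
  \<open>exp h - 1 \<le> h * exp h\<close>. Using it twice bounds \<open>exp h - 1 - h\<close> by
  \<open>h * (exp h - 1)\<close> and then by \<open>h * h * exp h\<close>.\<close>

lemma exp_quadratic_bound:
  fixes h :: real
  assumes "0 \<le> h"
  shows "exp h - 1 - h \<le> h\<^sup>2 * exp h"
proof -
  have "1 - h \<le> exp (- h)" using exp_ge_add_one_self[of "- h"] by simp
  then have "(1 - h) * exp h \<le> exp (- h) * exp h" by (intro mult_right_mono) auto
  then have 1: "exp h - 1 \<le> h * exp h" by (simp add: exp_minus algebra_simps)
  then have "h * (exp h - 1) \<le> h * (h * exp h)" using assms by (intro mult_left_mono)
  then show ?thesis using 1 by (simp add: algebra_simps power2_eq_square)
qed

text \<open>Each replaced factor costs a quadratic error in \<open>C * s\<close>, and the other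
  factors amplify it at most exponentially. For \<open>s = t / n\<close> and \<open>n\<close>
  factors the total is of order \<open>1 / n\<close>.\<close>

lemma exp_product_approx:
  fixes C s :: real and Bs :: "nat \<Rightarrow> (nat \<Rightarrow> 'k::{real_normed_field,banach}) \<Rightarrow> (nat \<Rightarrow> 'k)"
  assumes B: "\<And>i. lp_op p (Bs i)" "x \<in> lp_space p" "0 \<le> C"
    "\<And>i x. x \<in> lp_space p \<Longrightarrow> lp_norm p (Bs i x) \<le> C * lp_norm p x" and s: "0 \<le> s"
  defines "E \<equiv> \<lambda>l. foldr (\<lambda>i y. op_exp p (Bs i) s y) l x"
    and "V \<equiv> \<lambda>l. foldr (\<lambda>i y j. y j + of_real s * Bs i y j) l x"
  shows "E l \<in> lp_space p \<and> V l \<in> lp_space p \<and>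
     lp_norm p (E l) \<le> exp (C * s * real (length l)) * lp_norm p x \<and>
     lp_norm p (\<lambda>j. E l j - V l j) \<le> real (length l) * (C * s)\<^sup>2 * exp (C * s * real (length l)) * lp_norm p x"
proof (induction l)
  case Nil
  then show ?case using B by (simp add: E_def V_def)
next
  case (Cons i l)
  let ?h = "C * s" and ?y = "E l" and ?z = "V l" and ?n = "real (length l)"
  have h: "0 \<le> ?h" using B s by simp
  have y: "?y \<in> lp_space p" and z: "?z \<in> lp_space p" using Cons by auto
  have E: "E (i # l) = op_exp p (Bs i) s ?y" by (simp add: E_def)
  have V: "V (i # l) = (\<lambda>j. ?z j + of_real s * Bs i ?z j)" by (simp add: V_def)
  note oe = op_exp[OF B(1) y B(3) B(4) s, of i]
  have Esp: "E (i # l) \<in> lp_space p" using oe unfolding E by auto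
  have lin: "(\<lambda>j. u j + of_real s * Bs i u j) \<in> lp_space p"
      "lp_norm p (\<lambda>j. u j + of_real s * Bs i u j) \<le> exp ?h * lp_norm p u" if u: "u \<in> lp_space p" for u
  proof -
    note Bu = lp_op_space[OF B(1) u, of i]
    show "(\<lambda>j. u j + of_real s * Bs i u j) \<in> lp_space p"
      using u Bu by (intro lp_add lp_scale)
    have "lp_norm p (\<lambda>j. u j + of_real s * Bs i u j) \<le> lp_norm p u + s * lp_norm p (Bs i u)"
      using lp_add(2)[OF u lp_scale(1)[OF Bu, of "of_real s"]] lp_scale(2)[OF Bu, of "of_real s"] s by simp
    also have "\<dots> \<le> lp_norm p u + s * (C * lp_norm p u)"
      using B(4)[OF u] s by (intro add_mono mult_left_mono) auto
    also have "\<dots> = (1 + ?h) * lp_norm p u" by (simp add: algebra_simps)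
    also have "\<dots> \<le> exp ?h * lp_norm p u" using exp_ge_add_one_self[of ?h] by (intro mult_right_mono) auto
    finally show "lp_norm p (\<lambda>j. u j + of_real s * Bs i u j) \<le> exp ?h * lp_norm p u" .
  qed
  have Vsp: "V (i # l) \<in> lp_space p" unfolding V using z by (rule lin)
  have ee: "exp (?h * (?n + 1)) = exp ?h * exp (?h * ?n)" by (simp add: algebra_simps exp_add)
  have "lp_norm p (E (i # l)) \<le> exp ?h * lp_norm p ?y"
    using oe(2)[of 0] unfolding E by simp
  also have "\<dots> \<le> exp ?h * (exp (?h * ?n) * lp_norm p x)"
    using Cons by (intro mult_left_mono) auto
  finally have Ebd: "lp_norm p (E (i # l)) \<le> exp (?h * (?n + 1)) * lp_norm p x"
    unfolding ee by (simp add: mult_ac)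
  \<comment> \<open>The new error splits into \<open>?a\<close>, the linearization error of the
    outermost factor at the exact vector, and \<open>?b\<close>, the linearized factor applied to
    the error accumulated so far.\<close>
  let ?a = "\<lambda>j. E (i # l) j - (?y j + of_real s * Bs i ?y j)"
  let ?d = "\<lambda>j. ?y j - ?z j"
  let ?b = "\<lambda>j. ?d j + of_real s * Bs i ?d j"
  have d: "?d \<in> lp_space p" using y z by (rule lp_diff)
  have a: "?a \<in> lp_space p" using Esp lin(1)[OF y] by (rule lp_diff)
  have split: "(\<lambda>j. E (i # l) j - V (i # l) j) = (\<lambda>j. ?a j + ?b j)"
    unfolding V lp_op_diff[OF B(1) y z] by (simp add: algebra_simps)
  have "lp_norm p ?a \<le> (exp ?h - 1 - ?h) * lp_norm p ?y"
    using oe(2)[of 2] unfolding E by (simp add: numeral_2_eq_2 algebra_simps)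
  also have "\<dots> \<le> (?h\<^sup>2 * exp ?h) * (exp (?h * ?n) * lp_norm p x)"
    using exp_quadratic_bound[OF h] Cons by (intro mult_mono) auto
  finally have abd: "lp_norm p ?a \<le> ?h\<^sup>2 * exp (?h * (?n + 1)) * lp_norm p x" unfolding ee by (simp add: mult_ac)
  have "lp_norm p ?b \<le> exp ?h * lp_norm p ?d" by (rule lin(2)[OF d])
  also have "\<dots> \<le> exp ?h * (?n * ?h\<^sup>2 * exp (?h * ?n) * lp_norm p x)" using Cons by (intro mult_left_mono) auto
  finally have bbd: "lp_norm p ?b \<le> ?n * ?h\<^sup>2 * exp (?h * (?n + 1)) * lp_norm p x" unfolding ee by (simp add: mult_ac)
  have "lp_norm p (\<lambda>j. E (i # l) j - V (i # l) j) \<le> lp_norm p ?a + lp_norm p ?b"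
    unfolding split using a lin(1)[OF d] by (rule lp_add)
  also have "\<dots> \<le> (?n + 1) * ?h\<^sup>2 * exp (?h * (?n + 1)) * lp_norm p x"
    using abd bbd by (simp add: algebra_simps)
  finally show ?case using Esp Vsp Ebd by (simp add: add.commute)
qed

end

section \<open>Expectations of products of distinct random operators\<close>

text \<open>What the argument retains of the hypotheses, phrased with coordinate functionals.
  Linearity holds at every outcome, but the norm bound only almost surely, since it reaches the
  \<open>A_i\<close> through equality of laws. One constant \<open>r\<close> serves the operators
  and their mean.\<close>

locale random_lp_ops = lp_exponent p + prob_space M for p :: real and M :: "'w measure" +
  fixes B :: "nat \<Rightarrow> 'w \<Rightarrow> (nat \<Rightarrow> 'k::{real_normed_field,banach,second_countable_topology}) \<Rightarrow> (nat \<Rightarrow> 'k)"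
    and E :: "(nat \<Rightarrow> 'k) \<Rightarrow> (nat \<Rightarrow> 'k)" and r :: real
  assumes p_le_2: "p \<le> 2"
    and B_op: "\<And>i \<omega>. \<omega> \<in> space M \<Longrightarrow> lp_op p (B i \<omega>)"
    and B_meas: "\<And>i x j. x \<in> lp_space p \<Longrightarrow> (\<lambda>\<omega>. B i \<omega> x j) \<in> borel_measurable M"
    and r_nonneg: "0 \<le> r"
    and B_bound: "AE \<omega> in M. \<forall>i. \<forall>x\<in>lp_space p. lp_norm p (B i \<omega> x) \<le> r * lp_norm p x"
    and B_indep: "\<And>xs js. (\<And>i. xs i \<in> lp_space p) \<Longrightarrow> indep_vars (\<lambda>_. borel) (\<lambda>i \<omega>. B i \<omega> (xs i) (js i)) UNIV"
    and B_mean: "\<And>i x j. x \<in> lp_space p \<Longrightarrow> (\<integral>\<omega>. B i \<omega> x j \<partial>M) = E x j"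
    and E_op: "lp_op p E"
    and E_bound: "\<And>x. x \<in> lp_space p \<Longrightarrow> lp_norm p (E x) \<le> r * lp_norm p x"
begin

abbreviation word :: "'w \<Rightarrow> nat list \<Rightarrow> (nat \<Rightarrow> 'k) \<Rightarrow> (nat \<Rightarrow> 'k)" where
  "word \<omega> \<equiv> word_op (\<lambda>i. B i \<omega>)"

lemma word_lp: "\<omega> \<in> space M \<Longrightarrow> x \<in> lp_space p \<Longrightarrow> word \<omega> w x \<in> lp_space p"
  by (rule word_op_lp[OF B_op])

lemma word_bound:
  "AE \<omega> in M. \<forall>w. \<forall>x\<in>lp_space p. lp_norm p (word \<omega> w x) \<le> r ^ length w * lp_norm p x"
  using B_bound AE_space
proof eventually_elim
  case (elim \<omega>)
  show ?case
    using word_op_bound[where Bs = "\<lambda>i. B i \<omega>", OF B_op[OF elim(2)] _ r_nonneg] elim(1) by blast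
qed

text \<open>Applying a random operator to a random vector is a limit of finite sums of products of
  entries, each of which is measurable.\<close>

lemma word_meas:
  assumes "x \<in> lp_space p"
  shows "(\<lambda>\<omega>. word \<omega> w x j) \<in> borel_measurable M"
proof (induction w arbitrary: j)
  case (Cons i w)
  have [measurable]: "(\<lambda>\<omega>. B i \<omega> (lp_unit a) j) \<in> borel_measurable M" for a
    by (rule B_meas[OF lp_unit])
  note Cons.IH[measurable]
  show ?case
  proof (rule borel_measurable_LIMSEQ_metric[where f = "\<lambda>N \<omega>. \<Sum>a<N. word \<omega> w x a * B i \<omega> (lp_unit a) j"])
    fix \<omega> assume "\<omega> \<in> space M"
    then show "(\<lambda>N. \<Sum>a<N. word \<omega> w x a * B i \<omega> (lp_unit a) j) \<longlonglongrightarrow> word \<omega> (i # w) x j"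
      using lp_op_coord_tendsto[OF B_op word_lp] assms by simp
  qed measurable
qed simp

lemma bounded_linear_meas:
  fixes F :: "'k \<Rightarrow> complex"
  assumes "bounded_linear F"
  shows "F \<in> borel_measurable borel"
  by (intro borel_measurable_continuous_onI linear_continuous_on assms)

lemma coord_B_bound:
  assumes "x \<in> lp_space p"
  shows "AE \<omega> in M. norm (B i \<omega> x j) \<le> r * lp_norm p x"
  using B_bound AE_space
proof eventually_elim
  case (elim \<omega>)
  then show ?case
    using lp_norm_coord[OF lp_op_space[OF B_op assms], of \<omega> i j] assms by (meson order_trans)
qed

lemma bounded_linear_AE_bound:
  fixes F :: "'k \<Rightarrow> complex"
  assumes "bounded_linear F" "AE \<omega> in M. norm (f \<omega>) \<le> K"
  obtains K' where "AE \<omega> in M. norm (F (f \<omega>)) \<le> K'"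
proof -
  obtain C where C: "\<And>y. norm (F y) \<le> norm y * C" "0 \<le> C"
    using bounded_linear.nonneg_bounded[OF assms(1)] by blast
  have "AE \<omega> in M. norm (F (f \<omega>)) \<le> K * C"
    using assms(2) by eventually_elim (meson C mult_right_mono order_trans)
  then show thesis by (rule that)
qed

lemma prod_AE_bound:
  fixes f :: "nat \<Rightarrow> 'w \<Rightarrow> complex"
  assumes "finite J" "\<And>k. k \<in> J \<Longrightarrow> \<exists>K. AE \<omega> in M. norm (f k \<omega>) \<le> K"
  shows "\<exists>K. AE \<omega> in M. norm (\<Prod>k\<in>J. f k \<omega>) \<le> K"
  using assms
proof (induction J rule: finite_induct)
  case (insert k J)
  obtain K1 where 1: "AE \<omega> in M. norm (f k \<omega>) \<le> K1" using insert.prems by blast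
  obtain K2 where 2: "AE \<omega> in M. norm (\<Prod>k\<in>J. f k \<omega>) \<le> K2" using insert by blast
  have "AE \<omega> in M. norm (\<Prod>k\<in>insert k J. f k \<omega>) \<le> K1 * K2"
    using 1 2
  proof eventually_elim
    case (elim \<omega>)
    then show ?case using insert.hyps
      by (simp add: norm_mult) (meson elim mult_mono norm_ge_zero order_trans)
  qed
  then show ?case by blast
qed (auto intro: exI[of _ 1])

text \<open>Independence is only assumed for one matrix coefficient of each operator, hence the random
  operators need not generate independent sigma-algebras. \<open>decoupled I R c\<close> keeps track of what survives:
  \<open>R\<close> may be replaced by the constant \<open>c\<close> under the expectation, next to any product of single coefficients
  of distinct operators with index outside \<open>I\<close>.\<close>

definition decoupled :: "nat set \<Rightarrow> ('w \<Rightarrow> complex) \<Rightarrow> complex \<Rightarrow> bool" where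
  "decoupled I R c \<longleftrightarrow> R \<in> borel_measurable M \<and> (\<exists>K. AE \<omega> in M. norm (R \<omega>) \<le> K) \<and>
    (\<forall>J xs js \<psi>. finite J \<longrightarrow> J \<inter> I = {} \<longrightarrow> (\<forall>k. xs k \<in> lp_space p) \<longrightarrow>
       (\<forall>k. bounded_linear (\<psi> k :: 'k \<Rightarrow> complex)) \<longrightarrow>
       (\<integral>\<omega>. R \<omega> * (\<Prod>k\<in>J. \<psi> k (B k \<omega> (xs k) (js k))) \<partial>M) = c * (\<Prod>k\<in>J. \<psi> k (E (xs k) (js k))))"

lemma decoupledD:
  assumes "decoupled I R c" "finite J" "J \<inter> I = {}" "\<And>k. xs k \<in> lp_space p"
    "\<And>k. bounded_linear (\<psi> k :: 'k \<Rightarrow> complex)"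
  shows "(\<integral>\<omega>. R \<omega> * (\<Prod>k\<in>J. \<psi> k (B k \<omega> (xs k) (js k))) \<partial>M) = c * (\<Prod>k\<in>J. \<psi> k (E (xs k) (js k)))"
  using assms(1)[unfolded decoupled_def, THEN conjunct2, THEN conjunct2, rule_format, OF assms(2-5)] .

lemma decoupled_integral: "decoupled I R c \<Longrightarrow> (\<integral>\<omega>. R \<omega> \<partial>M) = c"
  using decoupledD[of I R c "{}" "\<lambda>_ _. 0" "\<lambda>_ _. 0"] by (simp add: bounded_linear_zero)

lemma factor_meas:
  assumes "bounded_linear (\<psi> :: 'k \<Rightarrow> complex)" "x \<in> lp_space p"
  shows "(\<lambda>\<omega>. \<psi> (B k \<omega> x j)) \<in> borel_measurable M"
  using measurable_compose[OF B_meas bounded_linear_meas] assms by blast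

lemma factor_bound:
  assumes "bounded_linear (\<psi> :: 'k \<Rightarrow> complex)" "x \<in> lp_space p"
  shows "\<exists>K. AE \<omega> in M. norm (\<psi> (B k \<omega> x j)) \<le> K"
  using bounded_linear_AE_bound[OF assms(1) coord_B_bound[OF assms(2)]] by metis

text \<open>The base case, and the place where independence enters: expectations of finite products
  of single coefficients factor, and \<open>\<psi> k\<close> commutes with the integral.\<close>

lemma decoupled_one: "decoupled {} (\<lambda>_. 1) 1"
  unfolding decoupled_def
proof (intro conjI allI impI)
  fix J :: "nat set" and xs :: "nat \<Rightarrow> nat \<Rightarrow> 'k" and js :: "nat \<Rightarrow> nat" and \<psi> :: "nat \<Rightarrow> 'k \<Rightarrow> complex"
  assume J: "finite J" and xs: "\<forall>k. xs k \<in> lp_space p" and \<psi>: "\<forall>k. bounded_linear (\<psi> k :: 'k \<Rightarrow> complex)"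
  have ind: "indep_vars (\<lambda>_. borel) (\<lambda>k \<omega>. \<psi> k (B k \<omega> (xs k) (js k))) J"
    using xs \<psi> by (intro indep_vars_compose2[OF indep_vars_subset[OF B_indep]] bounded_linear_meas) auto
  have int: "integrable M (\<lambda>\<omega>. B k \<omega> (xs k) (js k))" for k
    using xs by (intro integrable_const_bound[OF coord_B_bound B_meas]) auto
  have int2: "integrable M (\<lambda>\<omega>. \<psi> k (B k \<omega> (xs k) (js k)))" for k
    using integrable_bounded_linear[OF spec[OF \<psi>] int] .
  have "(\<integral>\<omega>. (\<Prod>k\<in>J. \<psi> k (B k \<omega> (xs k) (js k))) \<partial>M) = (\<Prod>k\<in>J. \<integral>\<omega>. \<psi> k (B k \<omega> (xs k) (js k)) \<partial>M)"
    by (rule indep_vars_lebesgue_integral[OF J ind int2])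
  also have "\<dots> = (\<Prod>k\<in>J. \<psi> k (E (xs k) (js k)))"
    using integral_bounded_linear[OF spec[OF \<psi>] int] B_mean xs by simp
  finally show "(\<integral>\<omega>. 1 * (\<Prod>k\<in>J. \<psi> k (B k \<omega> (xs k) (js k))) \<partial>M) = 1 * (\<Prod>k\<in>J. \<psi> k (E (xs k) (js k)))"
    by simp
qed (auto intro: exI[of _ 1])

lemma coord_word_bound:
  assumes "x \<in> lp_space p"
  shows "AE \<omega> in M. norm (word \<omega> w x j) \<le> r ^ length w * lp_norm p x"
  using word_bound AE_space
proof eventually_elim
  case (elim \<omega>)
  then show ?case
    using lp_norm_coord[OF word_lp[OF _ assms], of \<omega> w j] assms by (meson order_trans)
qed

text \<open>The outermost operator of the word is expanded into its entries. For each fixed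
  \<open>a\<close> the entry \<open>B i \<omega> (lp_unit a) j\<close> is a single coefficient with
  a fresh index, so it may join the test product of the induction hypothesis, which is therefore
  needed at every coordinate. Multiplicativity of \<open>F\<close> separates the entry from the
  shorter word; dominated convergence restores the series. Both \<open>\<phi>\<close> and its
  complex conjugate will serve as \<open>F\<close>.\<close>

lemma decoupled_word:
  assumes R: "decoupled I R c" and x: "x \<in> lp_space p"
    and F: "bounded_linear F" "\<And>a b. F (a * b) = F a * F b"
    and w: "distinct w" "set w \<inter> I = {}"
  shows "decoupled (I \<union> set w) (\<lambda>\<omega>. R \<omega> * F (word \<omega> w x j)) (c * F ((E ^^ length w) x j))"
  using w
proof (induction w arbitrary: j)
  case Nil
  have R_meas: "R \<in> borel_measurable M" and RK: "\<exists>K. AE \<omega> in M. norm (R \<omega>) \<le> K"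
    using R unfolding decoupled_def by auto
  obtain K where K: "AE \<omega> in M. norm (R \<omega>) \<le> K" using RK by blast
  have "AE \<omega> in M. norm (R \<omega> * F (x j)) \<le> K * norm (F (x j))"
    using K by eventually_elim (simp add: norm_mult mult_right_mono)
  then have RK': "\<exists>K. AE \<omega> in M. norm (R \<omega> * F (x j)) \<le> K" by blast
  have eq: "(\<integral>\<omega>. R \<omega> * F (x j) * g \<omega> \<partial>M) = F (x j) * (\<integral>\<omega>. R \<omega> * g \<omega> \<partial>M)" for g
  proof -
    have "(\<integral>\<omega>. R \<omega> * F (x j) * g \<omega> \<partial>M) = (\<integral>\<omega>. F (x j) * (R \<omega> * g \<omega>) \<partial>M)" by (simp add: mult_ac)
    then show ?thesis by simp
  qed
  have "c * F (x j) * d = F (x j) * (c * d)" for d by simp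
  then show ?case
    using R R_meas RK' unfolding decoupled_def by (simp add: eq)
next
  case (Cons i w)
  interpret F: bounded_linear F by (rule F)
  note [measurable] = word_meas[OF x]
  note [measurable] = bounded_linear_meas[OF F(1)]
  have R_meas[measurable]: "R \<in> borel_measurable M" using R unfolding decoupled_def by auto
  obtain K where K: "AE \<omega> in M. norm (R \<omega>) \<le> K" using R unfolding decoupled_def by blast
  have IH: "decoupled (I \<union> set w) (\<lambda>\<omega>. R \<omega> * F (word \<omega> w x a)) (c * F ((E ^^ length w) x a))" for a
    using Cons by auto
  have Rw_bound: "\<exists>K. AE \<omega> in M. norm (R \<omega> * F (word \<omega> w x j)) \<le> K" for w j
  proof -
    obtain K' where K': "AE \<omega> in M. norm (F (word \<omega> w x j)) \<le> K'"
      using bounded_linear_AE_bound[OF F(1) coord_word_bound[OF x]] by blast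
    have "AE \<omega> in M. norm (R \<omega> * F (word \<omega> w x j)) \<le> K * K'"
      using K K' by eventually_elim (simp add: norm_mult, meson mult_mono norm_ge_zero order_trans)
    then show ?thesis by blast
  qed
  show ?case
    unfolding decoupled_def
  proof (intro conjI allI impI)
    show "(\<lambda>\<omega>. R \<omega> * F (word \<omega> (i # w) x j)) \<in> borel_measurable M" by measurable
    show "\<exists>K. AE \<omega> in M. norm (R \<omega> * F (word \<omega> (i # w) x j)) \<le> K" by (rule Rw_bound)
    fix J :: "nat set" and xs :: "nat \<Rightarrow> nat \<Rightarrow> 'k" and js :: "nat \<Rightarrow> nat" and \<psi> :: "nat \<Rightarrow> 'k \<Rightarrow> complex"
    assume J: "finite J" "J \<inter> (I \<union> set (i # w)) = {}" and xs: "\<forall>k. xs k \<in> lp_space p"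
      and \<psi>: "\<forall>k. bounded_linear (\<psi> k :: 'k \<Rightarrow> complex)"
    define Z where "Z \<omega> = (\<Prod>k\<in>J. \<psi> k (B k \<omega> (xs k) (js k)))" for \<omega>
    define z where "z = (\<Prod>k\<in>J. \<psi> k (E (xs k) (js k)))"
    have Z_meas[measurable]: "Z \<in> borel_measurable M"
      unfolding Z_def using \<psi> xs by (intro borel_measurable_prod factor_meas) auto
    have "\<exists>K. AE \<omega> in M. norm (Z \<omega>) \<le> K"
      unfolding Z_def by (rule prod_AE_bound[OF J(1) factor_bound[OF spec[OF \<psi>] spec[OF xs]]])
    then obtain KZ where KZ: "AE \<omega> in M. norm (Z \<omega>) \<le> KZ" by blast
    define g where "g a \<omega> = R \<omega> * F (word \<omega> w x a) * (F (B i \<omega> (lp_unit a) j) * Z \<omega>)" for a \<omega>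
    have [measurable]: "(\<lambda>\<omega>. F (B i \<omega> (lp_unit a) j)) \<in> borel_measurable M" for a
      using F(1) lp_unit by (rule factor_meas)
    have g_meas[measurable]: "g a \<in> borel_measurable M" for a unfolding g_def by measurable
    have g_int: "integrable M (g a)" for a
    proof -
      obtain K1 where K1: "AE \<omega> in M. norm (R \<omega> * F (word \<omega> w x a)) \<le> K1" using Rw_bound by blast
      obtain K2 where K2: "AE \<omega> in M. norm (F (B i \<omega> (lp_unit a) j)) \<le> K2"
        using factor_bound[OF F(1) lp_unit] by blast
      have "AE \<omega> in M. norm (g a \<omega>) \<le> K1 * (K2 * KZ)"
        using K1 K2 KZ
      proof eventually_elim
        case (elim \<omega>)
        have "norm (F (B i \<omega> (lp_unit a) j)) * norm (Z \<omega>) \<le> K2 * KZ"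
          using elim by (intro mult_mono) (auto intro: order_trans[OF norm_ge_zero])
        then show ?case unfolding g_def norm_mult[of "R \<omega> * F (word \<omega> w x a)"] norm_mult[of _ "Z \<omega>"]
          using elim by (intro mult_mono) (auto intro: order_trans[OF norm_ge_zero])
      qed
      then show ?thesis by (intro integrable_const_bound) auto
    qed
    have g_val: "(\<integral>\<omega>. g a \<omega> \<partial>M) = c * F ((E ^^ length w) x a) * (F (E (lp_unit a) j) * z)" for a
    proof -
      \<comment> \<open>Overwriting position \<open>i\<close> makes the entry of \<open>B i\<close>
        one more test coefficient; since \<open>i\<close> lies outside \<open>J\<close>, the old
        factors are unchanged.\<close>
      let ?xs = "xs(i := lp_unit a)" and ?js = "js(i := j)" and ?\<psi> = "\<psi>(i := F)"
      have iJ: "i \<notin> J" using J by auto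
      have "(\<integral>\<omega>. R \<omega> * F (word \<omega> w x a) * (\<Prod>k\<in>insert i J. ?\<psi> k (B k \<omega> (?xs k) (?js k))) \<partial>M)
        = c * F ((E ^^ length w) x a) * (\<Prod>k\<in>insert i J. ?\<psi> k (E (?xs k) (?js k)))"
      proof -
        have "insert i J \<inter> (I \<union> set w) = {}" using J Cons.prems by auto
        moreover have "?xs k \<in> lp_space p" for k using xs by (simp add: lp_unit)
        moreover have "bounded_linear (?\<psi> k)" for k using \<psi> F by simp
        ultimately show ?thesis using J(1) by (intro decoupledD[OF IH]) auto
      qed
      moreover have "(\<Prod>k\<in>insert i J. ?\<psi> k (B k \<omega> (?xs k) (?js k))) = F (B i \<omega> (lp_unit a) j) * Z \<omega>" for \<omega>
      proof -
        have "(\<Prod>k\<in>J. ?\<psi> k (B k \<omega> (?xs k) (?js k))) = Z \<omega>"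
          unfolding Z_def using iJ by (intro prod.cong) auto
        then show ?thesis using J(1) iJ by simp
      qed
      moreover have "(\<Prod>k\<in>insert i J. ?\<psi> k (E (?xs k) (?js k))) = F (E (lp_unit a) j) * z"
      proof -
        have "(\<Prod>k\<in>J. ?\<psi> k (E (?xs k) (?js k))) = z"
          unfolding z_def using iJ by (intro prod.cong) auto
        then show ?thesis using J(1) iJ by simp
      qed
      ultimately show ?thesis unfolding g_def by simp
    qed
    have g_sum: "(\<Sum>a<N. g a \<omega>) = R \<omega> * F (\<Sum>a<N. word \<omega> w x a * B i \<omega> (lp_unit a) j) * Z \<omega>" for N \<omega>
      by (simp add: g_def F.sum F(2) sum_distrib_left sum_distrib_right mult_ac)
    obtain C where C: "\<And>y. norm (F y) \<le> norm y * C" "0 \<le> C" using F.nonneg_bounded by blast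
    let ?b = "r * (r ^ length w * lp_norm p x)"
    have "(\<lambda>N. \<integral>\<omega>. (\<Sum>a<N. g a \<omega>) \<partial>M) \<longlonglongrightarrow> (\<integral>\<omega>. R \<omega> * F (word \<omega> (i # w) x j) * Z \<omega> \<partial>M)"
    proof (rule integral_dominated_convergence[where w = "\<lambda>_. K * (?b * C) * KZ"])
      show "AE \<omega> in M. (\<lambda>N. \<Sum>a<N. g a \<omega>) \<longlonglongrightarrow> R \<omega> * F (word \<omega> (i # w) x j) * Z \<omega>"
        using AE_space
      proof eventually_elim
        case (elim \<omega>)
        then show ?case unfolding g_sum
          using lp_op_coord_tendsto[OF B_op word_lp] x
          by (auto intro!: tendsto_intros F.tendsto)
      qed
      show "AE \<omega> in M. norm (\<Sum>a<N. g a \<omega>) \<le> K * (?b * C) * KZ" for N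
        using K KZ B_bound word_bound AE_space
      proof eventually_elim
        case (elim \<omega>)
        let ?s = "\<Sum>a<N. word \<omega> w x a * B i \<omega> (lp_unit a) j"
        have "norm ?s \<le> r * lp_norm p (word \<omega> w x)"
          using elim x by (intro lp_op_partial_bound[OF B_op word_lp r_nonneg]) auto
        also have "\<dots> \<le> ?b" using elim x r_nonneg by (intro mult_left_mono) auto
        finally have "norm ?s * C \<le> ?b * C" using C by (intro mult_right_mono)
        then have "norm (F ?s) \<le> ?b * C" using C(1)[of ?s] by linarith
        moreover have "0 \<le> K" "0 \<le> ?b * C" using elim C r_nonneg by (auto intro: order_trans[OF norm_ge_zero])
        ultimately show ?case unfolding g_sum norm_mult using elim r_nonneg C(2)
          by (intro mult_mono mult_nonneg_nonneg) auto
      qed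
    qed (use g_meas in measurable)
    moreover have "(\<integral>\<omega>. (\<Sum>a<N. g a \<omega>) \<partial>M) = c * F (\<Sum>a<N. (E ^^ length w) x a * E (lp_unit a) j) * z" for N
      using g_int by (simp add: g_val F.sum F(2) sum_distrib_left sum_distrib_right mult_ac)
    moreover have "(\<lambda>N. c * F (\<Sum>a<N. (E ^^ length w) x a * E (lp_unit a) j) * z) \<longlonglongrightarrow> c * F (E ((E ^^ length w) x) j) * z"
      using lp_op_funpow(1)[OF E_op x r_nonneg E_bound]
      by (intro tendsto_intros F.tendsto lp_op_coord_tendsto E_op) auto
    ultimately have "(\<integral>\<omega>. R \<omega> * F (word \<omega> (i # w) x j) * Z \<omega> \<partial>M) = c * F (E ((E ^^ length w) x) j) * z"
      using LIMSEQ_unique by simp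
    then show "(\<integral>\<omega>. R \<omega> * F (word \<omega> (i # w) x j) * (\<Prod>k\<in>J. \<psi> k (B k \<omega> (xs k) (js k))) \<partial>M)
      = c * F ((E ^^ length (i # w)) x j) * (\<Prod>k\<in>J. \<psi> k (E (xs k) (js k)))"
      unfolding Z_def z_def by simp
  qed
qed

end

section \<open>Second moments\<close>

lemma (in lp_exponent) l2_norm_sums:
  assumes "p \<le> 2" "x \<in> lp_space p"
  shows "(\<lambda>i. (norm (x i))\<^sup>2) sums (lp_norm 2 x)\<^sup>2"
proof -
  interpret l2: lp_exponent 2 by unfold_locales simp
  have x: "x \<in> lp_space 2" using l2_le_lp[OF assms] by blast
  then have "summable (\<lambda>i. (norm (x i))\<^sup>2)" by (simp add: lp_space_def)
  moreover have "(lp_norm 2 x)\<^sup>2 = (\<Sum>i. (norm (x i))\<^sup>2)"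
    using l2.lp_norm_powr[OF x] by simp
  ultimately show ?thesis by (simp add: summable_sums)
qed

lemma (in lp_exponent) l2_partial_sum_le:
  assumes "p \<le> 2" "x \<in> lp_space p" "lp_norm p x \<le> s"
  shows "(\<Sum>j<J. (norm (x j))\<^sup>2) \<le> s\<^sup>2"
proof -
  have "(\<Sum>j<J. (norm (x j))\<^sup>2) \<le> (lp_norm 2 x)\<^sup>2"
    using l2_norm_sums[OF assms(1,2)] sum_le_suminf[of "\<lambda>i. (norm (x i))\<^sup>2" "{..<J}"]
    by (simp add: sums_iff)
  also have "\<dots> \<le> s\<^sup>2"
    using l2_le_lp(2)[OF assms(1,2)] assms(3) by (intro power_mono) auto
  finally show ?thesis .
qed

context random_lp_ops begin

lemma E_pow_lp: "x \<in> lp_space p \<Longrightarrow> (E ^^ m) x \<in> lp_space p"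
  by (rule lp_op_funpow(1)[OF E_op _ r_nonneg E_bound])

lemma E_pow_bound: "x \<in> lp_space p \<Longrightarrow> lp_norm p ((E ^^ m) x) \<le> r ^ m * lp_norm p x"
  by (rule lp_op_funpow(2)[OF E_op _ r_nonneg E_bound])

lemma centered_word_lp:
  "\<omega> \<in> space M \<Longrightarrow> x \<in> lp_space p \<Longrightarrow> (\<lambda>j. word \<omega> w x j - (E ^^ m) x j) \<in> lp_space p"
  by (intro lp_diff word_lp E_pow_lp)

lemma centered_word_bound:
  assumes "x \<in> lp_space p"
  shows "AE \<omega> in M. \<forall>w. lp_norm p (\<lambda>j. word \<omega> w x j - (E ^^ length w) x j) \<le> 2 * r ^ length w * lp_norm p x"
  using word_bound AE_space
proof eventually_elim
  case (elim \<omega>)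
  show ?case
  proof
    fix w
    show "lp_norm p (\<lambda>j. word \<omega> w x j - (E ^^ length w) x j) \<le> 2 * r ^ length w * lp_norm p x"
      using lp_diff(2)[OF word_lp[OF elim(2) assms] E_pow_lp[OF assms], of w "length w"]
        bspec[OF spec[OF elim(1), of w] assms] E_pow_bound[OF assms, of "length w"] by simp
  qed
qed

text \<open>Expanding the square gives a sum over pairs of words. Pairs without a common letter have
  covariance zero, and every other pair contributes at most the squared size of one centered word.
  The bound is uniform in the number \<open>J\<close> of coordinates.\<close>

lemma second_moment_partial:
  assumes x: "x \<in> lp_space p" and W: "finite W" "\<And>w. w \<in> W \<Longrightarrow> distinct w" "\<And>w. w \<in> W \<Longrightarrow> length w = m"
  defines "S \<equiv> \<lambda>\<omega> j. \<Sum>w\<in>W. word \<omega> w x j - (E ^^ m) x j"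
  shows "(\<integral>\<omega>. (\<Sum>j<J. (norm (S \<omega> j))\<^sup>2) \<partial>M)
    \<le> real (card {q \<in> W \<times> W. set (fst q) \<inter> set (snd q) \<noteq> {}}) * (2 * r ^ m * lp_norm p x)\<^sup>2"
proof -
  obtain \<phi> :: "'k \<Rightarrow> complex" where \<phi>: "bounded_linear \<phi>" "\<And>x y. \<phi> (x * y) = \<phi> x * \<phi> y" "\<And>x. cmod (\<phi> x) = norm x"
    using isometric_embedding_complex by blast
  interpret \<phi>: bounded_linear \<phi> by (rule \<phi>)
  let ?s = "2 * r ^ m * lp_norm p x"
  define e where "e j = \<phi> ((E ^^ m) x j)" for j
  define b where "b w j \<omega> = \<phi> (word \<omega> w x j) - e j" for w j \<omega>
  have b_diff: "b w j \<omega> = \<phi> (word \<omega> w x j - (E ^^ m) x j)" for w j \<omega>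
    by (simp add: b_def e_def \<phi>.diff)
  have [measurable]: "cnj \<in> borel_measurable borel"
    by (intro borel_measurable_continuous_onI continuous_intros)
  have a_meas[measurable]: "(\<lambda>\<omega>. \<phi> (word \<omega> w x j)) \<in> borel_measurable M" for w j
    using measurable_compose[OF word_meas[OF x] bounded_linear_meas[OF \<phi>(1)]] by simp
  have b_meas[measurable]: "b w j \<in> borel_measurable M" for w j
    unfolding b_def by measurable
  have b_sum: "AE \<omega> in M. (\<Sum>j<J. (cmod (b w j \<omega>))\<^sup>2) \<le> ?s\<^sup>2" if "w \<in> W" for w J
    using centered_word_bound[OF x] AE_space
  proof eventually_elim
    case (elim \<omega>)
    then show ?case
      using l2_partial_sum_le[OF p_le_2 centered_word_lp[OF elim(2) x], of w m ?s J] W(3)[OF that]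
        elim(1) unfolding b_diff \<phi>(3) by blast
  qed
  have a_bound: "AE \<omega> in M. cmod (\<phi> (word \<omega> w x j)) \<le> r ^ length w * lp_norm p x" for w j
    unfolding \<phi>(3) by (rule coord_word_bound[OF x])
  have a_int: "integrable M (\<lambda>\<omega>. \<phi> (word \<omega> w x j))" for w j
    by (rule integrable_const_bound[OF a_bound a_meas])
  have aa_int: "integrable M (\<lambda>\<omega>. \<phi> (word \<omega> w x j) * cnj (\<phi> (word \<omega> w' x j)))" for w w' j
  proof (rule integrable_const_bound)
    show "AE \<omega> in M. cmod (\<phi> (word \<omega> w x j) * cnj (\<phi> (word \<omega> w' x j)))
      \<le> (r ^ length w * lp_norm p x) * (r ^ length w' * lp_norm p x)"
      using a_bound[of w j] a_bound[of w' j]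
    proof eventually_elim
      case (elim \<omega>)
      then show ?case unfolding norm_mult complex_mod_cnj using r_nonneg
        by (intro mult_mono) auto
    qed
  qed measurable
  have ca_int: "integrable M (\<lambda>\<omega>. cnj (\<phi> (word \<omega> w x j)))" for w j
    using a_int by simp
  have expand: "b w j \<omega> * cnj (b w' j \<omega>) = \<phi> (word \<omega> w x j) * cnj (\<phi> (word \<omega> w' x j))
      - e j * cnj (\<phi> (word \<omega> w' x j)) - cnj (e j) * \<phi> (word \<omega> w x j) + e j * cnj (e j)" for w w' j \<omega>
    by (simp add: b_def algebra_simps)
  have bb_int: "integrable M (\<lambda>\<omega>. b w j \<omega> * cnj (b w' j \<omega>))" for w w' j
    unfolding expand using aa_int a_int ca_int by simp
  \<comment> \<open>The covariance has four terms. By decoupling first one and then both words, each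
    expectation becomes \<open>e j * cnj (e j)\<close>, and the signs cancel.\<close>
  have zero: "(\<integral>\<omega>. b w j \<omega> * cnj (b w' j \<omega>) \<partial>M) = 0"
    if w: "w \<in> W" "w' \<in> W" "set w \<inter> set w' = {}" for w w' j
  proof -
    have cphi: "bounded_linear (\<lambda>y. cnj (\<phi> y))"
      using bounded_linear_compose[OF bounded_linear_cnj \<phi>(1)] by simp
    have D1: "decoupled ({} \<union> set w) (\<lambda>\<omega>. 1 * \<phi> (word \<omega> w x j)) (1 * \<phi> ((E ^^ length w) x j))"
      using W w by (intro decoupled_word[OF decoupled_one x \<phi>(1,2)]) auto
    have D2: "decoupled ({} \<union> set w \<union> set w') (\<lambda>\<omega>. 1 * \<phi> (word \<omega> w x j) * cnj (\<phi> (word \<omega> w' x j)))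
        (1 * \<phi> ((E ^^ length w) x j) * cnj (\<phi> ((E ^^ length w') x j)))"
      using W w \<phi>(2) by (intro decoupled_word[OF D1 x cphi]) auto
    have D3: "decoupled ({} \<union> set w') (\<lambda>\<omega>. 1 * cnj (\<phi> (word \<omega> w' x j))) (1 * cnj (\<phi> ((E ^^ length w') x j)))"
      using W w \<phi>(2) by (intro decoupled_word[OF decoupled_one x cphi]) auto
    show ?thesis
      unfolding expand using decoupled_integral[OF D1] decoupled_integral[OF D2] decoupled_integral[OF D3]
        aa_int a_int ca_int W(3) w by (simp add: e_def prob_space algebra_simps del: integral_cnj)
  qed
  let ?bad = "{q \<in> W \<times> W. set (fst q) \<inter> set (snd q) \<noteq> {}}"
  let ?g = "\<lambda>q j \<omega>. b (fst q) j \<omega> * cnj (b (snd q) j \<omega>)"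
  have sq: "(norm (S \<omega> j))\<^sup>2 = (\<Sum>q\<in>W \<times> W. Re (?g q j \<omega>))" for \<omega> j
  proof -
    have "\<phi> (S \<omega> j) = (\<Sum>w\<in>W. b w j \<omega>)" by (simp add: S_def \<phi>.sum b_diff)
    then have "complex_of_real ((norm (S \<omega> j))\<^sup>2) = (\<Sum>w\<in>W. b w j \<omega>) * cnj (\<Sum>w\<in>W. b w j \<omega>)"
      using complex_norm_square[of "\<phi> (S \<omega> j)"] unfolding \<phi>(3) by (simp only: of_real_power)
    also have "\<dots> = (\<Sum>q\<in>W \<times> W. ?g q j \<omega>)"
      by (simp add: cnj_sum sum_product sum.cartesian_product case_prod_beta)
    finally have "Re (complex_of_real ((norm (S \<omega> j))\<^sup>2)) = Re (\<Sum>q\<in>W \<times> W. ?g q j \<omega>)" by (rule arg_cong)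
    then show ?thesis unfolding Re_complex_of_real Re_sum .
  qed
  have g_int: "integrable M (\<lambda>\<omega>. Re (?g q j \<omega>))" for q j
    using bb_int by (rule integrable_Re)
  have g_zero: "(\<integral>\<omega>. Re (?g q j \<omega>) \<partial>M) = 0" if "q \<in> W \<times> W - ?bad" for q j
    using zero[of "fst q" "snd q" j] that bb_int by (subst integral_Re) auto
  \<comment> \<open>Bounding each product by half the sum of squares before summing over
    \<open>j\<close> reduces to the two centered words separately, so no factor \<open>J\<close>
    appears.\<close>
  have pair: "(\<integral>\<omega>. (\<Sum>j<J. Re (?g q j \<omega>)) \<partial>M) \<le> ?s\<^sup>2" if q: "q \<in> W \<times> W" for q
  proof (rule integral_le_const)
    show "integrable M (\<lambda>\<omega>. \<Sum>j<J. Re (?g q j \<omega>))" by (rule Bochner_Integration.integrable_sum[OF g_int])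
    have "fst q \<in> W" "snd q \<in> W" using q by auto
    from b_sum[OF this(1), of J] b_sum[OF this(2), of J]
    show "AE \<omega> in M. (\<Sum>j<J. Re (?g q j \<omega>)) \<le> ?s\<^sup>2"
    proof eventually_elim
      case (elim \<omega>)
      have "Re (?g q j \<omega>) \<le> ((cmod (b (fst q) j \<omega>))\<^sup>2 + (cmod (b (snd q) j \<omega>))\<^sup>2) / 2" for j
      proof -
        have "Re (?g q j \<omega>) \<le> cmod (b (fst q) j \<omega>) * cmod (b (snd q) j \<omega>)"
          by (rule order_trans[OF complex_Re_le_cmod]) (simp add: norm_mult)
        also have "\<dots> \<le> ((cmod (b (fst q) j \<omega>))\<^sup>2 + (cmod (b (snd q) j \<omega>))\<^sup>2) / 2"
          using sum_squares_bound[of "cmod (b (fst q) j \<omega>)" "cmod (b (snd q) j \<omega>)"] by simp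
        finally show ?thesis .
      qed
      then have "(\<Sum>j<J. Re (?g q j \<omega>)) \<le> (\<Sum>j<J. ((cmod (b (fst q) j \<omega>))\<^sup>2 + (cmod (b (snd q) j \<omega>))\<^sup>2) / 2)"
        by (rule sum_mono)
      also have "\<dots> = ((\<Sum>j<J. (cmod (b (fst q) j \<omega>))\<^sup>2) + (\<Sum>j<J. (cmod (b (snd q) j \<omega>))\<^sup>2)) / 2"
        by (simp add: sum.distrib flip: sum_divide_distrib)
      also have "\<dots> \<le> ?s\<^sup>2" using elim by simp
      finally show ?case .
    qed
  qed
  have "(\<integral>\<omega>. (\<Sum>j<J. (norm (S \<omega> j))\<^sup>2) \<partial>M) = (\<Sum>q\<in>W \<times> W. \<Sum>j<J. \<integral>\<omega>. Re (?g q j \<omega>) \<partial>M)"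
    unfolding sq using g_int by (simp add: sum.swap[where A = "{..<J}"])
  also have "\<dots> = (\<Sum>q\<in>?bad. \<Sum>j<J. \<integral>\<omega>. Re (?g q j \<omega>) \<partial>M)"
    using W(1) g_zero by (intro sum.mono_neutral_right) auto
  also have "\<dots> = (\<Sum>q\<in>?bad. \<integral>\<omega>. (\<Sum>j<J. Re (?g q j \<omega>)) \<partial>M)"
    using g_int by simp
  also have "\<dots> \<le> (\<Sum>q\<in>?bad. ?s\<^sup>2)"
    using pair by (intro sum_mono) auto
  finally show ?thesis by simp
qed

lemma centered_sum_lp:
  assumes "\<omega> \<in> space M" "x \<in> lp_space p"
  shows "(\<lambda>j. \<Sum>w\<in>W. word \<omega> w x j - (E ^^ m) x j) \<in> lp_space p"
  using assms by (intro lp_sum centered_word_lp)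

text \<open>The squared norm is the limit of its coordinate sums, so the uniform second moment bound
  survives \<open>J \<rightarrow> \<infinity>\<close>; Markov's inequality does the rest.\<close>

lemma second_moment_tail:
  assumes x: "x \<in> lp_space p" and W: "finite W" "\<And>w. w \<in> W \<Longrightarrow> distinct w" "\<And>w. w \<in> W \<Longrightarrow> length w = m"
    and c: "0 < c"
  defines "D \<equiv> \<lambda>\<omega>. (lp_norm 2 (\<lambda>j. \<Sum>w\<in>W. word \<omega> w x j - (E ^^ m) x j))\<^sup>2"
  shows "{\<omega> \<in> space M. c \<le> D \<omega>} \<in> sets M"
    "prob {\<omega> \<in> space M. c \<le> D \<omega>}
      \<le> real (card {q \<in> W \<times> W. set (fst q) \<inter> set (snd q) \<noteq> {}}) * (2 * r ^ m * lp_norm p x)\<^sup>2 / c"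
proof -
  let ?S = "\<lambda>\<omega> j. \<Sum>w\<in>W. word \<omega> w x j - (E ^^ m) x j"
  let ?s = "2 * r ^ m * lp_norm p x"
  let ?N = "real (card {q \<in> W \<times> W. set (fst q) \<inter> set (snd q) \<noteq> {}}) * ?s\<^sup>2"
  have [measurable]: "(\<lambda>\<omega>. word \<omega> w x j) \<in> borel_measurable M" for w j by (rule word_meas[OF x])
  have lim: "(\<lambda>J. \<Sum>j<J. (norm (?S \<omega> j))\<^sup>2) \<longlonglongrightarrow> D \<omega>" if "\<omega> \<in> space M" for \<omega>
    using l2_norm_sums[OF p_le_2 centered_sum_lp[OF that x, where W = W and m = m]]
    unfolding sums_def D_def .
  have D_meas[measurable]: "D \<in> borel_measurable M"
    by (rule borel_measurable_LIMSEQ_metric[OF _ lim]) measurable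
  show sets: "{\<omega> \<in> space M. c \<le> D \<omega>} \<in> sets M" by measurable
  \<comment> \<open>A crude triangle inequality bound: it only dominates the integrands, and its
    growth in \<open>card W\<close> does not enter the result.\<close>
  have bd: "AE \<omega> in M. norm (\<Sum>j<J. (norm (?S \<omega> j))\<^sup>2) \<le> (real (card W) * ?s)\<^sup>2" for J
    using centered_word_bound[OF x] AE_space
  proof eventually_elim
    case (elim \<omega>)
    have "lp_norm p (?S \<omega>) \<le> (\<Sum>w\<in>W. lp_norm p (\<lambda>j. word \<omega> w x j - (E ^^ m) x j))"
      using elim x by (intro lp_sum centered_word_lp)
    also have "\<dots> \<le> (\<Sum>w\<in>W. ?s)" using elim W(3) by (intro sum_mono) force
    finally have "lp_norm p (?S \<omega>) \<le> real (card W) * ?s" by simp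
    from l2_partial_sum_le[OF p_le_2 centered_sum_lp[OF elim(2) x] this]
    show ?case by (simp add: sum_nonneg)
  qed
  have conv: "(\<lambda>J. \<integral>\<omega>. (\<Sum>j<J. (norm (?S \<omega> j))\<^sup>2) \<partial>M) \<longlonglongrightarrow> (\<integral>\<omega>. D \<omega> \<partial>M)"
    and int: "integrable M D"
  proof -
    have 1: "AE \<omega> in M. (\<lambda>J. \<Sum>j<J. (norm (?S \<omega> j))\<^sup>2) \<longlonglongrightarrow> D \<omega>"
      using AE_space by eventually_elim (rule lim)
    have 2: "(\<lambda>\<omega>. \<Sum>j<J. (norm (?S \<omega> j))\<^sup>2) \<in> borel_measurable M" for J by measurable
    show "(\<lambda>J. \<integral>\<omega>. (\<Sum>j<J. (norm (?S \<omega> j))\<^sup>2) \<partial>M) \<longlonglongrightarrow> (\<integral>\<omega>. D \<omega> \<partial>M)"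
      by (rule integral_dominated_convergence[OF D_meas 2 _ 1 bd]) simp
    show "integrable M D"
      by (rule integrable_dominated_convergence[OF D_meas 2 _ 1 bd]) simp
  qed
  have "(\<integral>\<omega>. D \<omega> \<partial>M) \<le> ?N"
    by (rule LIMSEQ_le_const2[OF conv]) (use second_moment_partial[OF x W] in blast)
  moreover have "prob {\<omega> \<in> space M. c \<le> D \<omega>} \<le> (\<integral>\<omega>. D \<omega> \<partial>M) / c"
    using int c by (intro integral_Markov_inequality_measure[where A = "{}"]) (auto simp: D_def)
  ultimately show "prob {\<omega> \<in> space M. c \<le> D \<omega>} \<le> ?N / c"
    using c by (meson divide_right_mono less_imp_le order_trans)
qed

end

section \<open>Counting increasing words and pairs that meet\<close>

definition words :: "nat \<Rightarrow> nat \<Rightarrow> nat list set" where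
  "words n m = {w \<in> set (List.subseqs [0..<n]). length w = m}"

lemma finite_words [simp]: "finite (words n m)"
  unfolding words_def by (rule finite_subset[OF _ finite_set[of "List.subseqs [0..<n]"]]) blast

lemma words_distinct: "w \<in> words n m \<Longrightarrow> distinct w"
  by (auto simp: words_def intro: subseqs_distinctD)

lemma words_length: "w \<in> words n m \<Longrightarrow> length w = m"
  by (simp add: words_def)

lemma inj_on_set_subseqs: "inj_on set (set (List.subseqs [0..<n]))"
  using distinct_set_subseqs[of "[0..<n]"] by (simp add: distinct_map)

text \<open>Words are lists because the operators do not commute, but they are counted as sets: an
  increasing word is determined by its letters.\<close>

lemma bij_betw_words: "bij_betw set (words n m) {S. S \<subseteq> {..<n} \<and> card S = m}"
proof -
  have "set ` words n m = {S. S \<subseteq> {..<n} \<and> card S = m}"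
  proof (intro equalityI subsetI)
    fix S assume "S \<in> set ` words n m"
    then obtain w where w: "w \<in> words n m" "S = set w" by blast
    then have "S \<in> set ` set (List.subseqs [0..<n])" unfolding words_def by blast
    then have "S \<subseteq> {..<n}" unfolding subseqs_powset by auto
    moreover have "card S = m" using w distinct_card[OF words_distinct[OF w(1)]] words_length by auto
    ultimately show "S \<in> {S. S \<subseteq> {..<n} \<and> card S = m}" by simp
  next
    fix S assume S: "S \<in> {S. S \<subseteq> {..<n} \<and> card S = m}"
    then have "S \<in> set ` set (List.subseqs [0..<n])" unfolding subseqs_powset by auto
    then obtain w where w: "w \<in> set (List.subseqs [0..<n])" "S = set w" by blast
    then have "length w = m" using distinct_card[OF subseqs_distinctD[OF w(1)]] S by simp
    then show "S \<in> set ` words n m" using w unfolding words_def by blast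
  qed
  moreover have "inj_on set (words n m)"
    by (rule inj_on_subset[OF inj_on_set_subseqs[of n]]) (auto simp: words_def)
  ultimately show ?thesis by (simp add: bij_betw_def)
qed

lemma words_subset: "w \<in> words n m \<Longrightarrow> set w \<subseteq> {..<n}"
  and words_card: "w \<in> words n m \<Longrightarrow> card (set w) = m"
  using bij_betwE[OF bij_betw_words[of n m]] by blast+

lemma card_words: "card (words n m) = n choose m"
  using bij_betw_same_card[OF bij_betw_words] n_subsets[of "{..<n}" m] by simp

text \<open>Deleting the prescribed letter maps these words injectively to subsets of size
  \<open>m - 1\<close>.\<close>

lemma card_words_containing:
  assumes "0 < m"
  shows "card {w \<in> words n m. i \<in> set w} \<le> n ^ (m - 1)"
proof -
  let ?T = "{S. S \<subseteq> {..<n} \<and> card S = m - 1}"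
  have "card {w \<in> words n m. i \<in> set w} \<le> card ?T"
  proof (rule card_inj_on_le)
    show "inj_on (\<lambda>w. set w - {i}) {w \<in> words n m. i \<in> set w}"
    proof (rule inj_onI)
      fix w w' assume a: "w \<in> {w \<in> words n m. i \<in> set w}" "w' \<in> {w \<in> words n m. i \<in> set w}"
        "set w - {i} = set w' - {i}"
      then have "set w = set w'" by blast
      then show "w = w'" using a bij_betw_words[of n m] by (auto simp: bij_betw_def dest: inj_onD)
    qed
    show "(\<lambda>w. set w - {i}) ` {w \<in> words n m. i \<in> set w} \<subseteq> ?T"
    proof
      fix S assume "S \<in> (\<lambda>w. set w - {i}) ` {w \<in> words n m. i \<in> set w}"
      then obtain w where w: "w \<in> words n m" "i \<in> set w" "S = set w - {i}" by blast
      then show "S \<in> ?T" using words_subset[OF w(1)] words_card[OF w(1)] by auto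
    qed
  qed (auto intro: finite_subset[of _ "Pow {..<n}"])
  also have "card ?T = n choose (m - 1)" using n_subsets[of "{..<n}"] by simp
  also have "\<dots> \<le> n ^ (m - 1)"
    using binomial_fact_pow[of n "m - 1"] by (metis fact_ge_1 le_trans mult.right_neutral mult_le_mono2)
  finally show ?thesis .
qed

text \<open>Two words that meet share some letter \<open>i < n\<close>, which leaves at most
  \<open>n ^ (m - 1)\<close> choices for each of them. Summing over \<open>i\<close> gives order
  \<open>n ^ (2 * m - 1)\<close>; the factor \<open>n\<close> on the left avoids subtraction in the
  exponent.\<close>

lemma card_intersecting_words:
  "card {q \<in> words n m \<times> words n m. set (fst q) \<inter> set (snd q) \<noteq> {}} * n \<le> n ^ (2 * m)" (is "card ?A * n \<le> _")
proof (cases "m = 0")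
  case True
  then have A: "?A = {}" by (auto simp: words_def)
  show ?thesis unfolding A by simp
next
  case False
  let ?C = "\<lambda>i. {w \<in> words n m. i \<in> set w}"
  have sub: "?A \<subseteq> (\<Union>i<n. ?C i \<times> ?C i)"
  proof
    fix q assume q: "q \<in> ?A"
    then obtain i where i: "i \<in> set (fst q)" "i \<in> set (snd q)" by blast
    moreover have "set (fst q) \<subseteq> {..<n}" using q words_subset[of "fst q" n m] by auto
    ultimately show "q \<in> (\<Union>i<n. ?C i \<times> ?C i)" using q by (cases q) auto
  qed
  have "card ?A \<le> card (\<Union>i<n. ?C i \<times> ?C i)" using sub by (intro card_mono) auto
  also have "\<dots> \<le> (\<Sum>i<n. card (?C i \<times> ?C i))" by (rule card_UN_le) simp
  also have "\<dots> \<le> (\<Sum>i<n. n ^ (m - 1) * n ^ (m - 1))"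
    unfolding card_cartesian_product using False card_words_containing by (intro sum_mono mult_le_mono) auto
  finally have "card ?A * n \<le> n * (n ^ (m - 1) * n ^ (m - 1)) * n" by simp
  also have "\<dots> = (n * n ^ (m - 1)) * (n * n ^ (m - 1))" by (simp add: mult_ac)
  also have "n * n ^ (m - 1) = n ^ m" using False by (simp flip: power_Suc)
  finally show ?thesis by (simp add: power_add[symmetric] mult_2)
qed

section \<open>Convergence of the products\<close>

definition exp_tail :: "nat \<Rightarrow> real \<Rightarrow> real" where
  "exp_tail K h = exp h - (\<Sum>k<K. h ^ k / fact k)"

lemma exp_sums_fact: "(\<lambda>k. h ^ k / fact k) sums exp (h::real)"
  using exp_converges[of h] by (simp add: field_simps)

text \<open>The tail is itself a power series with nonnegative coefficients.\<close>

lemma exp_tail_mono: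
  assumes "0 \<le> h" "h \<le> h'"
  shows "exp_tail K h \<le> exp_tail K h'"
proof -
  have e: "exp_tail K u = (\<Sum>k. u ^ (k + K) / fact (k + K))" for u
    using suminf_minus_initial_segment[OF sums_summable[OF exp_sums_fact[of u]], of K] exp_sums_fact[of u]
    by (simp add: exp_tail_def sums_iff)
  have s: "summable (\<lambda>k. u ^ (k + K) / fact (k + K))" for u :: real
    by (rule summable_ignore_initial_segment[OF sums_summable[OF exp_sums_fact]])
  show ?thesis unfolding e
    using assms by (intro suminf_le s divide_right_mono power_mono) auto
qed

lemma sum_le_exp_tail:
  assumes "0 \<le> h" "K \<le> N"
  shows "(\<Sum>k=K..<N. h ^ k / fact k) \<le> exp_tail K h"
proof -
  have "(\<Sum>k<N. h ^ k / fact k) \<le> exp h"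
    using sum_le_suminf[OF sums_summable[OF exp_sums_fact[of h]], of "{..<N}"] exp_sums_fact[of h] assms(1)
    by (simp add: sums_iff)
  moreover have "(\<Sum>k<N. h ^ k / fact k) = (\<Sum>k<K. h ^ k / fact k) + (\<Sum>k=K..<N. h ^ k / fact k)"
    using assms(2) sum.atLeastLessThan_concat[of 0 K N "\<lambda>k. h ^ k / fact k"] by (simp add: lessThan_atLeast0)
  ultimately show ?thesis by (simp add: exp_tail_def)
qed

lemma exp_tail_tendsto: "(\<lambda>K. exp_tail K h) \<longlonglongrightarrow> 0"
proof -
  have "(\<lambda>K. exp h - (\<Sum>k<K. h ^ k / fact k)) \<longlonglongrightarrow> exp h - exp h"
    using exp_sums_fact[of h] unfolding sums_def by (intro tendsto_intros)
  then show ?thesis by (simp add: exp_tail_def)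
qed

text \<open>The normalized number of words of length \<open>m\<close> tends to the coefficient of
  the exponential series; this is how the limit semigroup arises.\<close>

lemma binomial_ratio_tendsto: "(\<lambda>n. real (n choose m) / real n ^ m) \<longlonglongrightarrow> 1 / fact m"
proof -
  have "(\<lambda>n. (real n - real i) / real n) \<longlonglongrightarrow> 1" for i
  proof (rule Lim_transform_eventually)
    show "(\<lambda>n. 1 - real i / real n) \<longlonglongrightarrow> 1"
      using tendsto_diff[OF tendsto_const lim_const_over_n[of "real i"], of 1] by simp
    show "\<forall>\<^sub>F n in sequentially. 1 - real i / real n = (real n - real i) / real n"
      using eventually_gt_at_top[of 0] by eventually_elim (simp add: field_simps)
  qed
  then have "(\<lambda>n. (\<Prod>i<m. (real n - real i) / real n) / fact m) \<longlonglongrightarrow> (\<Prod>i<m. 1) / fact m"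
    by (intro tendsto_intros) auto
  moreover have "(\<Prod>i<m. (real n - real i) / real n) / fact m = real (n choose m) / real n ^ m" for n
    by (simp add: binomial_gbinomial gbinomial_prod_rev prod_dividef lessThan_atLeast0)
  ultimately show ?thesis by simp
qed

lemma binomial_ratio_le: "real (n choose m) / real n ^ m \<le> 1 / fact m"
proof -
  have "real ((n choose m) * fact m) \<le> real (n ^ m)" using binomial_fact_pow of_nat_le_iff by blast
  then have "real (n choose m) * fact m \<le> real n ^ m" by simp
  then show ?thesis
    \<comment> \<open>The denominator vanishes for \<open>n = 0\<close> and \<open>m > 0\<close>;
      the quotient is then 0 by the convention on division.\<close>
    by (cases "real n ^ m = 0") (simp_all only: div_by_0, simp_all add: field_simps)
qed

text \<open>Grouping by length. Any \<open>N\<close> above \<open>n\<close> will do because longer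
  words do not exist, so \<open>N\<close> can later be taken beyond the cutoff as well.\<close>

lemma sum_subseqs_eq:
  fixes f :: "nat list \<Rightarrow> 'a::comm_monoid_add"
  assumes "n < N"
  shows "(\<Sum>w\<leftarrow>List.subseqs [0..<n]. f w) = (\<Sum>m<N. \<Sum>w\<in>words n m. f w)"
proof -
  let ?L = "List.subseqs [0..<n]"
  have "distinct ?L" using distinct_set_subseqs[of "[0..<n]"] by (simp add: distinct_map)
  then have "(\<Sum>w\<leftarrow>?L. f w) = sum f (set ?L)" by (rule sum_list_distinct_conv_sum_set)
  also have "\<dots> = (\<Sum>m<N. sum f {w \<in> set ?L. length w = m})"
  proof (rule sum.group[symmetric])
    have "length w < N" if "w \<in> set ?L" for w
    proof -
      have w: "w \<in> words n (length w)" using that unfolding words_def by simp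
      have "length w \<le> n"
        using card_mono[OF _ words_subset[OF w]] words_card[OF w] by simp
      then show ?thesis using assms by simp
    qed
    then show "length ` set ?L \<subseteq> {..<N}" by blast
  qed auto
  finally show ?thesis by (simp only: words_def)
qed

context random_lp_ops begin

text \<open>Comparing coefficients of the powers of \<open>t\<close> makes the bound uniform in \<open>t\<close>: on the right-hand side
  only the finitely many random vectors bounded by \<open>\<eta> * real n ^ m\<close> depend on \<open>\<omega>\<close>.\<close>

lemma product_deviation:
  assumes \<omega>: "\<omega> \<in> space M" and bd: "\<forall>i. \<forall>x\<in>lp_space p. lp_norm p (B i \<omega> x) \<le> r * lp_norm p x"
    and x: "x \<in> lp_space p" and t: "0 \<le> t" "t \<le> T" and n: "0 < n"
    and S: "\<And>m. m < K \<Longrightarrow> lp_norm 2 (\<lambda>j. \<Sum>w\<in>words n m. word \<omega> w x j - (E ^^ m) x j) \<le> \<eta> * real n ^ m"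
  shows "lp_norm 2 (\<lambda>j. W_op p (\<lambda>i. B i \<omega>) n t x j - op_exp p E t x j)
    \<le> (r * T)\<^sup>2 / n * exp (r * T) * lp_norm p x
      + (\<Sum>m<K. T ^ m * (\<eta> + \<bar>real (n choose m) / real n ^ m - 1 / fact m\<bar> * (r ^ m * lp_norm p x)))
      + 2 * (exp_tail K (r * T) * lp_norm p x)"
proof -
  interpret l2: lp_exponent 2 by unfold_locales simp
  define s where "s = t / n"
  have s: "0 \<le> s" "s * n = t" using t n by (auto simp: s_def)
  have T: "0 \<le> T" using t by simp
  note bd' = bd[rule_format]
  have wl: "word \<omega> w x \<in> lp_space p" for w by (rule word_lp[OF \<omega> x])
  have wb: "lp_norm p (word \<omega> w x) \<le> r ^ length w * lp_norm p x" for w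
    using word_op_bound[where Bs = "\<lambda>i. B i \<omega>", OF B_op[OF \<omega>] x r_nonneg bd'] .
  note to2 = l2_le_lp[OF p_le_2]
  define W where "W = foldr (\<lambda>i y. op_exp p (B i \<omega>) s y) [0..<n] x"
  define V where "V = foldr (\<lambda>i y j. y j + of_real s * B i \<omega> y j) [0..<n] x"
  have approx: "W \<in> lp_space p" "V \<in> lp_space p"
    "lp_norm p (\<lambda>j. W j - V j) \<le> real (length [0..<n]) * (r * s)\<^sup>2 * exp (r * s * real (length [0..<n])) * lp_norm p x"
    using exp_product_approx[where Bs = "\<lambda>i. B i \<omega>", OF B_op[OF \<omega>] x r_nonneg bd' s(1), of "[0..<n]"]
    unfolding W_def V_def by blast+
  have W_eq: "W_op p (\<lambda>i. B i \<omega>) n t x = W" by (simp add: W_op_def W_def s_def)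
  define Y where "Y m j = (\<Sum>w\<in>words n m. word \<omega> w x j)" for m j
  \<comment> \<open>Large enough to include all words in \<open>n\<close> letters and to allow
    splitting the sum at \<open>K\<close>.\<close>
  define N where "N = K + n + 1"
  have V_eq: "V j = (\<Sum>m<N. of_real (s ^ m) * Y m j)" for j
  proof -
    have "V j = (\<Sum>w\<leftarrow>List.subseqs [0..<n]. of_real s ^ length w * word \<omega> w x j)"
      unfolding V_def lin_product_expand[where Bs = "\<lambda>i. B i \<omega>", OF B_op[OF \<omega>] x] ..
    also have "\<dots> = (\<Sum>m<N. \<Sum>w\<in>words n m. of_real s ^ length w * word \<omega> w x j)"
      by (rule sum_subseqs_eq) (simp add: N_def)
    also have "\<dots> = (\<Sum>m<N. of_real (s ^ m) * Y m j)"
      unfolding Y_def sum_distrib_left by (intro sum.cong refl) (simp add: words_length)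
    finally show ?thesis .
  qed
  define R where "R j = op_exp p E t x j - (\<Sum>m<K. of_real (t ^ m / fact m) * (E ^^ m) x j)" for j
  note oe = op_exp[OF E_op x r_nonneg E_bound t(1)]
  have R: "R \<in> lp_space p" unfolding R_def
    using oe(1) E_pow_lp[OF x] by (intro lp_diff lp_sum lp_scale) auto
  have R_bd: "lp_norm p R \<le> exp_tail K (r * T) * lp_norm p x"
  proof -
    have "lp_norm p R \<le> exp_tail K (r * t) * lp_norm p x"
      using oe(2)[of K] unfolding R_def exp_tail_def .
    also have "\<dots> \<le> exp_tail K (r * T) * lp_norm p x"
      using t r_nonneg by (intro mult_right_mono exp_tail_mono mult_left_mono) auto
    finally show ?thesis .
  qed
  have Y: "Y m \<in> lp_space p" "lp_norm p (Y m) \<le> real (n choose m) * (r ^ m * lp_norm p x)" for m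
  proof -
    show "Y m \<in> lp_space p" unfolding Y_def by (intro lp_sum wl)
    have "lp_norm p (Y m) \<le> (\<Sum>w\<in>words n m. lp_norm p (word \<omega> w x))"
      unfolding Y_def by (intro lp_sum wl)
    also have "\<dots> \<le> (\<Sum>w\<in>words n m. r ^ m * lp_norm p x)"
      using wb words_length by (intro sum_mono) metis
    finally show "lp_norm p (Y m) \<le> real (n choose m) * (r ^ m * lp_norm p x)" by (simp add: card_words)
  qed
  \<comment> \<open>The contribution of long words. There are \<open>n choose m\<close> of them at
    length \<open>m\<close>, so after normalization the scalar exponential tail dominates, whatever
    the outcome.\<close>
  define Q where "Q j = (\<Sum>m=K..<N. of_real (s ^ m) * Y m j)" for j
  have Q: "Q \<in> lp_space p" unfolding Q_def by (intro lp_sum lp_scale Y)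
  have Q_bd: "lp_norm p Q \<le> exp_tail K (r * T) * lp_norm p x"
  proof -
    have "lp_norm p Q \<le> (\<Sum>m=K..<N. lp_norm p (\<lambda>j. of_real (s ^ m) * Y m j))"
      unfolding Q_def by (intro lp_sum lp_scale Y)
    also have "\<dots> \<le> (\<Sum>m=K..<N. (r * T) ^ m / fact m * lp_norm p x)"
    proof (rule sum_mono)
      fix m
      have "lp_norm p (\<lambda>j. of_real (s ^ m) * Y m j) = s ^ m * lp_norm p (Y m)"
        unfolding lp_scale(2)[OF Y(1)] using s by (simp add: norm_power)
      also have "\<dots> \<le> s ^ m * (real (n choose m) * (r ^ m * lp_norm p x))"
        using s by (intro mult_left_mono Y) auto
      also have "\<dots> = (t * r) ^ m * (real (n choose m) / real n ^ m) * lp_norm p x"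
        by (simp add: s_def power_divide power_mult_distrib)
      also have "\<dots> \<le> (t * r) ^ m * (1 / fact m) * lp_norm p x"
        using t r_nonneg by (intro mult_right_mono mult_left_mono binomial_ratio_le) auto
      also have "\<dots> \<le> (r * T) ^ m * (1 / fact m) * lp_norm p x"
        using t r_nonneg by (intro mult_right_mono power_mono) (auto simp: mult.commute[of t] mult_left_mono)
      finally show "lp_norm p (\<lambda>j. of_real (s ^ m) * Y m j) \<le> (r * T) ^ m / fact m * lp_norm p x" by simp
    qed
    also have "\<dots> = (\<Sum>m=K..<N. (r * T) ^ m / fact m) * lp_norm p x" by (simp add: sum_distrib_right)
    also have "\<dots> \<le> exp_tail K (r * T) * lp_norm p x"
      using T r_nonneg by (intro mult_right_mono sum_le_exp_tail) (auto simp: N_def)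
    finally show ?thesis .
  qed
  define P where "P m j = of_real (s ^ m) * Y m j - of_real (t ^ m / fact m) * (E ^^ m) x j" for m j
  define D where "D m j = (\<Sum>w\<in>words n m. word \<omega> w x j - (E ^^ m) x j)" for m j
  have D: "D m \<in> lp_space p" for m unfolding D_def by (rule centered_sum_lp[OF \<omega> x])
  let ?\<beta> = "\<lambda>m. real (n choose m) / real n ^ m - 1 / fact m"
  \<comment> \<open>The discrepancy at degree \<open>m\<close> has a random part, the centered sum
    controlled by \<open>\<eta>\<close>, and a deterministic part, because the number of words over
    \<open>n ^ m\<close> is not exactly \<open>1 / fact m\<close>.\<close>
  have P_eq: "P m = (\<lambda>j. of_real (s ^ m) * D m j + of_real (t ^ m * ?\<beta> m) * (E ^^ m) x j)" for m
  proof
    fix j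
    have "Y m j = D m j + of_real (real (n choose m)) * (E ^^ m) x j"
      by (simp add: Y_def D_def sum_subtractf card_words)
    moreover have "t ^ m * ?\<beta> m = s ^ m * real (n choose m) - t ^ m / fact m"
      by (simp add: s_def power_divide right_diff_distrib)
    ultimately show "P m j = of_real (s ^ m) * D m j + of_real (t ^ m * ?\<beta> m) * (E ^^ m) x j"
      unfolding P_def by (simp only: of_real_diff of_real_mult) (simp add: algebra_simps)
  qed
  have P: "P m \<in> lp_space p" for m unfolding P_def by (intro lp_diff lp_scale Y E_pow_lp x)
  have P_bd: "lp_norm 2 (P m) \<le> T ^ m * (\<eta> + \<bar>?\<beta> m\<bar> * (r ^ m * lp_norm p x))" if m: "m < K" for m
  proof -
    have D2: "D m \<in> lp_space 2" and E2: "(E ^^ m) x \<in> lp_space 2" using to2 D E_pow_lp[OF x] by auto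
    have "lp_norm 2 (D m) \<le> \<eta> * real n ^ m" using S[OF m] unfolding D_def .
    then have D_bd: "lp_norm 2 (D m) / real n ^ m \<le> \<eta>" using n by (simp add: field_simps)
    have "lp_norm 2 (P m) \<le> s ^ m * lp_norm 2 (D m) + t ^ m * \<bar>?\<beta> m\<bar> * lp_norm 2 ((E ^^ m) x)"
      unfolding P_eq
      by (rule order_trans[OF l2.lp_add(2)[OF l2.lp_scale(1)[OF D2] l2.lp_scale(1)[OF E2]]])
         (use s t in \<open>simp only: l2.lp_scale(2)[OF D2] l2.lp_scale(2)[OF E2] norm_of_real abs_mult power_abs abs_of_nonneg\<close>)
    also have "\<dots> \<le> t ^ m * \<eta> + t ^ m * \<bar>?\<beta> m\<bar> * (r ^ m * lp_norm p x)"
    proof (intro add_mono mult_left_mono)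
      have "s ^ m * lp_norm 2 (D m) = t ^ m * (lp_norm 2 (D m) / real n ^ m)"
        by (simp add: s_def power_divide)
      also have "\<dots> \<le> t ^ m * \<eta>" using t D_bd by (intro mult_left_mono) auto
      finally show "s ^ m * lp_norm 2 (D m) \<le> t ^ m * \<eta>" .
      show "lp_norm 2 ((E ^^ m) x) \<le> r ^ m * lp_norm p x"
        using to2(2)[OF E_pow_lp[OF x]] E_pow_bound[OF x] order_trans by blast
    qed (use t in auto)
    also have "\<dots> = t ^ m * (\<eta> + \<bar>?\<beta> m\<bar> * (r ^ m * lp_norm p x))" by (simp add: algebra_simps)
    also have "\<dots> \<le> T ^ m * (\<eta> + \<bar>?\<beta> m\<bar> * (r ^ m * lp_norm p x))"
    proof (intro mult_right_mono power_mono)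
      have "0 \<le> lp_norm 2 (D m) / real n ^ m" by simp
      then have "0 \<le> \<eta>" using D_bd by linarith
      then show "0 \<le> \<eta> + \<bar>?\<beta> m\<bar> * (r ^ m * lp_norm p x)" using r_nonneg by simp
    qed (use t in auto)
    finally show ?thesis .
  qed
  have WV_bd: "lp_norm p (\<lambda>j. W j - V j) \<le> (r * T)\<^sup>2 / n * exp (r * T) * lp_norm p x"
  proof -
    have "real (length [0..<n]) * (r * s)\<^sup>2 * exp (r * s * real (length [0..<n])) = (r * t)\<^sup>2 / n * exp (r * t)"
      using n by (simp add: s_def power2_eq_square)
    also have "\<dots> \<le> (r * T)\<^sup>2 / n * exp (r * T)"
      using t r_nonneg by (intro mult_mono divide_right_mono power_mono) (auto intro: mult_left_mono)
    finally have "real (length [0..<n]) * (r * s)\<^sup>2 * exp (r * s * real (length [0..<n])) * lp_norm p x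
      \<le> (r * T)\<^sup>2 / n * exp (r * T) * lp_norm p x" by (intro mult_right_mono) auto
    then show ?thesis using approx(3) by linarith
  qed
  define G where "G = (\<lambda>j. W j - V j)"
  define H where "H = (\<lambda>j. \<Sum>m<K. P m j)"
  have G: "G \<in> lp_space p" unfolding G_def using approx by (intro lp_diff)
  have H: "H \<in> lp_space p" unfolding H_def by (intro lp_sum P)
  have H_bd: "lp_norm 2 H \<le> (\<Sum>m<K. T ^ m * (\<eta> + \<bar>?\<beta> m\<bar> * (r ^ m * lp_norm p x)))"
  proof -
    have "lp_norm 2 H \<le> (\<Sum>m<K. lp_norm 2 (P m))" unfolding H_def by (intro l2.lp_sum to2 P)
    also have "\<dots> \<le> (\<Sum>m<K. T ^ m * (\<eta> + \<bar>?\<beta> m\<bar> * (r ^ m * lp_norm p x)))"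
      by (intro sum_mono P_bd) simp
    finally show ?thesis .
  qed
  have split: "(\<lambda>j. W j - op_exp p E t x j) = (\<lambda>j. (G j + H j) + (Q j - R j))"
  proof
    fix j
    have "V j = (\<Sum>m<K. of_real (s ^ m) * Y m j) + Q j"
      unfolding V_eq Q_def N_def
      using sum.atLeastLessThan_concat[of 0 K "K + n + 1" "\<lambda>m. of_real (s ^ m) * Y m j"]
      by (simp only: lessThan_atLeast0)
    moreover have "H j = (\<Sum>m<K. of_real (s ^ m) * Y m j) - (\<Sum>m<K. of_real (t ^ m / fact m) * (E ^^ m) x j)"
      unfolding H_def P_def by (rule sum_subtractf)
    ultimately show "W j - op_exp p E t x j = (G j + H j) + (Q j - R j)"
      unfolding G_def R_def by (simp add: algebra_simps)
  qed
  have "lp_norm 2 (\<lambda>j. W j - op_exp p E t x j) \<le> lp_norm 2 (\<lambda>j. G j + H j) + lp_norm 2 (\<lambda>j. Q j - R j)"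
    unfolding split using to2(1) G H Q R by (intro l2.lp_add l2.lp_diff) auto
  also have "\<dots> \<le> (lp_norm 2 G + lp_norm 2 H) + (lp_norm 2 Q + lp_norm 2 R)"
    using to2(1) G H Q R by (intro add_mono l2.lp_add l2.lp_diff) auto
  also have "\<dots> \<le> ((r * T)\<^sup>2 / n * exp (r * T) * lp_norm p x +
      (\<Sum>m<K. T ^ m * (\<eta> + \<bar>?\<beta> m\<bar> * (r ^ m * lp_norm p x)))) + (exp_tail K (r * T) * lp_norm p x + exp_tail K (r * T) * lp_norm p x)"
    using to2(2)[OF G] WV_bd H_bd to2(2)[OF Q] Q_bd to2(2)[OF R] R_bd unfolding G_def[symmetric]
    by (intro add_mono) auto
  finally show ?thesis unfolding W_eq by linarith
qed

end

lemma outer_prob_le: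
  assumes "prob_space M" "A \<in> sets M" "S \<subseteq> A"
  shows "outer_prob M S \<le> measure M A"
  unfolding outer_prob_def using assms by (intro cInf_lower) (auto intro: bdd_belowI[of _ 0])

lemma outer_prob_nonneg:
  assumes "prob_space M" "S \<subseteq> space M"
  shows "0 \<le> outer_prob M S"
  unfolding outer_prob_def using assms by (intro cInf_greatest) (auto intro: exI[of _ "space M"])

context random_lp_ops begin

text \<open>Outside the null set where the operator bound fails and the events
  \<open>Bad n m\<close> with \<open>m < K\<close>, the deviation is at most a deterministic
  \<open>\<gamma> n\<close> for all \<open>t\<close> at once. Each bad event has probability of
  order \<open>1 / n\<close>.\<close>

lemma product_converges_in_probability:
  assumes x: "x \<in> lp_space p" and T: "0 < T" and \<epsilon>: "0 < \<epsilon>"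
  shows "(\<lambda>n. outer_prob M {\<omega> \<in> space M. (SUP t\<in>{0..T}.
      ereal (lp_norm 2 (\<lambda>j. W_op p (\<lambda>i. B i \<omega>) n t x j - op_exp p E t x j))) > ereal \<epsilon>}) \<longlonglongrightarrow> 0"
    (is "(\<lambda>n. outer_prob M (?A n)) \<longlonglongrightarrow> 0")
proof -
  let ?nx = "lp_norm p x"
  have "(\<lambda>K. 2 * (exp_tail K (r * T) * ?nx)) \<longlonglongrightarrow> 2 * (0 * ?nx)"
    by (intro tendsto_intros exp_tail_tendsto)
  then have "\<forall>\<^sub>F K in sequentially. 2 * (exp_tail K (r * T) * ?nx) < \<epsilon> / 2"
    by (rule order_tendstoD) (use \<epsilon> in simp)
  then obtain K where K: "2 * (exp_tail K (r * T) * ?nx) < \<epsilon> / 2"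
    by (auto simp: eventually_sequentially)
  \<comment> \<open>Half of \<open>\<epsilon>\<close> is shared among the word lengths with weights
    \<open>T ^ m\<close>; adding 1 keeps the denominator positive when \<open>K = 0\<close>.\<close>
  define \<eta> where "\<eta> = \<epsilon> / (2 * ((\<Sum>m<K. T ^ m) + 1))"
  have sT: "0 \<le> (\<Sum>m<K. T ^ m)" using T by (intro sum_nonneg) auto
  have \<eta>: "0 < \<eta>" using \<epsilon> sT by (simp add: \<eta>_def)
  have \<eta>T: "(\<Sum>m<K. T ^ m) * \<eta> \<le> \<epsilon> / 2"
    unfolding \<eta>_def using \<epsilon> sT by (simp add: field_simps)
  let ?\<beta> = "\<lambda>n m. \<bar>real (n choose m) / real n ^ m - 1 / fact m\<bar>"
  \<comment> \<open>In the limit the linearization error and the binomial discrepancies vanish,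
    leaving at most \<open>\<epsilon> / 2\<close> from the fluctuations and less than
    \<open>\<epsilon> / 2\<close> from the tails.\<close>
  define \<gamma> where "\<gamma> n = (r * T)\<^sup>2 / real n * exp (r * T) * ?nx
      + (\<Sum>m<K. T ^ m * (\<eta> + ?\<beta> n m * (r ^ m * ?nx))) + 2 * (exp_tail K (r * T) * ?nx)" for n
  have "\<gamma> \<longlonglongrightarrow> 0 * exp (r * T) * ?nx + (\<Sum>m<K. T ^ m * (\<eta> + \<bar>1 / fact m - 1 / fact m\<bar> * (r ^ m * ?nx)))
      + 2 * (exp_tail K (r * T) * ?nx)"
    unfolding \<gamma>_def by (intro tendsto_intros lim_const_over_n binomial_ratio_tendsto)
  moreover have "0 * exp (r * T) * ?nx + (\<Sum>m<K. T ^ m * (\<eta> + \<bar>1 / fact m - 1 / fact m\<bar> * (r ^ m * ?nx)))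
      + 2 * (exp_tail K (r * T) * ?nx) < \<epsilon>"
    using \<eta>T K by (simp flip: sum_distrib_right)
  ultimately have ev: "\<forall>\<^sub>F n in sequentially. \<gamma> n < \<epsilon>" by (rule order_tendstoD)
  obtain Nul where Nul: "{\<omega> \<in> space M. \<not> (\<forall>i. \<forall>x\<in>lp_space p. lp_norm p (B i \<omega> x) \<le> r * lp_norm p x)} \<subseteq> Nul"
      "Nul \<in> null_sets M"
    using B_bound by (auto elim!: AE_E simp: null_sets_def)
  define D where "D n m \<omega> = (lp_norm 2 (\<lambda>j. \<Sum>w\<in>words n m. word \<omega> w x j - (E ^^ m) x j))\<^sup>2" for n m \<omega>
  define Bad where "Bad n m = {\<omega> \<in> space M. (\<eta> * real n ^ m)\<^sup>2 \<le> D n m \<omega>}" for n m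
  let ?s = "\<lambda>m. 2 * r ^ m * ?nx"
  \<comment> \<open>The threshold \<open>(\<eta> * real n ^ m)^2\<close> grows like the number of
    all pairs of words, whereas only the pairs that meet contribute to the second moment; the
    quotient leaves \<open>1 / n\<close>.\<close>
  have Bad: "Bad n m \<in> sets M" "prob (Bad n m) \<le> (?s m)\<^sup>2 / \<eta>\<^sup>2 / real n" if n: "0 < n" for n m
  proof -
    have c: "0 < (\<eta> * real n ^ m)\<^sup>2" using \<eta> n by simp
    let ?c = "card {q \<in> words n m \<times> words n m. set (fst q) \<inter> set (snd q) \<noteq> {}}"
    note tail = second_moment_tail[OF x finite_words words_distinct words_length c, of n m]
    show "Bad n m \<in> sets M" unfolding Bad_def D_def by (rule tail(1))
    have "prob (Bad n m) \<le> real ?c * (?s m)\<^sup>2 / (\<eta> * real n ^ m)\<^sup>2"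
      unfolding Bad_def D_def by (rule tail(2))
    also have "\<dots> = (?s m)\<^sup>2 / \<eta>\<^sup>2 * (real ?c / real n ^ (2 * m))"
      by (simp add: power_mult_distrib power_mult[symmetric] mult_ac)
    also have "\<dots> \<le> (?s m)\<^sup>2 / \<eta>\<^sup>2 * (1 / real n)"
    proof (intro mult_left_mono)
      have "real (?c * n) \<le> real (n ^ (2 * m))" using card_intersecting_words of_nat_le_iff by blast
      then show "real ?c / real n ^ (2 * m) \<le> 1 / real n" using n by (simp add: field_simps)
    qed auto
    finally show "prob (Bad n m) \<le> (?s m)\<^sup>2 / \<eta>\<^sup>2 / real n" by simp
  qed
  have sub: "?A n \<subseteq> Nul \<union> (\<Union>m<K. Bad n m)" if n: "0 < n" and g: "\<gamma> n < \<epsilon>" for n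
  proof
    fix \<omega> assume \<omega>: "\<omega> \<in> ?A n"
    show "\<omega> \<in> Nul \<union> (\<Union>m<K. Bad n m)"
    proof (rule ccontr)
      assume no: "\<omega> \<notin> Nul \<union> (\<Union>m<K. Bad n m)"
      have sp: "\<omega> \<in> space M" using \<omega> by simp
      have bd: "\<forall>i. \<forall>x\<in>lp_space p. lp_norm p (B i \<omega> x) \<le> r * lp_norm p x" using no sp Nul(1) by blast
      have S: "lp_norm 2 (\<lambda>j. \<Sum>w\<in>words n m. word \<omega> w x j - (E ^^ m) x j) \<le> \<eta> * real n ^ m" if "m < K" for m
      proof -
        have "\<omega> \<notin> Bad n m" using no that by blast
        then have "D n m \<omega> \<le> (\<eta> * real n ^ m)\<^sup>2" using sp unfolding Bad_def by simp
        moreover have "0 \<le> \<eta> * real n ^ m" using \<eta> by simp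
        ultimately show ?thesis unfolding D_def by (rule power2_le_imp_le)
      qed
      have "(SUP t\<in>{0..T}. ereal (lp_norm 2 (\<lambda>j. W_op p (\<lambda>i. B i \<omega>) n t x j - op_exp p E t x j))) \<le> ereal (\<gamma> n)"
        unfolding \<gamma>_def using product_deviation[OF sp bd x _ _ n S] by (intro SUP_least) simp
      also have "\<dots> < ereal \<epsilon>" using g by simp
      finally show False using \<omega> order.asym by blast
    qed
  qed
  have le: "\<forall>\<^sub>F n in sequentially. outer_prob M (?A n) \<le> (\<Sum>m<K. (?s m)\<^sup>2 / \<eta>\<^sup>2 / real n)"
    using ev eventually_gt_at_top[of 0]
  proof eventually_elim
    case (elim n)
    have sets: "(\<Union>m<K. Bad n m) \<in> sets M" using Bad(1)[OF elim(2)] by auto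
    have "outer_prob M (?A n) \<le> prob (Nul \<union> (\<Union>m<K. Bad n m))"
      using Nul(2) sets by (intro outer_prob_le prob_space_axioms sub elim) auto
    also have "\<dots> \<le> prob Nul + prob (\<Union>m<K. Bad n m)"
      using Nul(2) sets by (intro measure_Un_le) auto
    also have "\<dots> \<le> 0 + (\<Sum>m<K. prob (Bad n m))"
      using Nul(2) Bad(1)[OF elim(2)] by (intro add_mono finite_measure_subadditive_finite)
        (auto simp: null_sets_def measure_def)
    also have "\<dots> \<le> (\<Sum>m<K. (?s m)\<^sup>2 / \<eta>\<^sup>2 / real n)"
      using Bad(2)[OF elim(2)] by (simp add: sum_mono)
    finally show ?case .
  qed
  show ?thesis
  proof (rule tendsto_sandwich[OF _ le tendsto_const])
    show "\<forall>\<^sub>F n in sequentially. 0 \<le> outer_prob M (?A n)"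
      by (intro always_eventually allI outer_prob_nonneg prob_space_axioms) auto
    have "(\<lambda>n. \<Sum>m<K. (?s m)\<^sup>2 / \<eta>\<^sup>2 / real n) \<longlonglongrightarrow> (\<Sum>m<K. 0)"
      by (intro tendsto_intros lim_const_over_n)
    then show "(\<lambda>n. \<Sum>m<K. (?s m)\<^sup>2 / \<eta>\<^sup>2 / real n) \<longlonglongrightarrow> 0" by simp
  qed
qed

end

section \<open>The Pettis integral and almost sure bounds\<close>

context lp_exponent begin

lemma lp_norm_unit: "lp_norm p (lp_unit a :: nat \<Rightarrow> 'k::real_normed_field) = 1"
proof -
  have "(\<lambda>i. norm (lp_unit a i :: 'k) powr p) = (\<lambda>i. if i = a then 1 else 0)"
    by (auto simp: lp_unit_def)
  then show ?thesis using sums_single[of a "\<lambda>_. 1 :: real"] by (simp add: lp_norm_def sums_iff)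
qed

lemma lp_dual_coord: "lp_dual p (\<lambda>x. x j)"
  unfolding lp_dual_def using lp_norm_coord by (auto intro!: exI[of _ 1])

text \<open>A functional is turned into a rank-one operator, so that the convergence results for
  operators apply to it.\<close>

lemma lp_dual_op:
  assumes "lp_dual p f"
  shows "lp_op p (\<lambda>y i. f y * lp_unit 0 i)"
proof -
  obtain C where C: "\<And>x. x \<in> lp_space p \<Longrightarrow> norm (f x) \<le> C * lp_norm p x"
    using assms unfolding lp_dual_def by blast
  show ?thesis
    unfolding lp_op_def
  proof (intro conjI ballI allI)
    show "\<exists>C. \<forall>x\<in>lp_space p. lp_norm p (\<lambda>i. f x * lp_unit 0 i) \<le> C * lp_norm p x"
      using C by (auto simp: lp_scale(2)[OF lp_unit] lp_norm_unit)
  qed (use assms in \<open>auto simp: lp_dual_def algebra_simps intro: lp_scale lp_unit\<close>)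
qed

lemma lp_dual_tendsto:
  assumes "lp_dual p f" "x \<in> lp_space p"
  shows "(\<lambda>N. \<Sum>a<N. x a * f (lp_unit a)) \<longlonglongrightarrow> f x"
  using lp_op_coord_tendsto[OF lp_dual_op[OF assms(1)] assms(2), of 0] by (simp add: lp_unit_def)

lemma lp_dual_partial_bound:
  assumes "lp_dual p f"
  obtains C where "0 \<le> C" "\<And>x N. x \<in> lp_space p \<Longrightarrow> norm (\<Sum>a<N. x a * f (lp_unit a)) \<le> C * lp_norm p x"
proof -
  obtain C where C: "0 \<le> C" "\<And>x. x \<in> lp_space p \<Longrightarrow> lp_norm p (\<lambda>i. f x * lp_unit 0 i) \<le> C * lp_norm p x"
    using lp_op_bound[OF lp_dual_op[OF assms]] by blast
  have "norm (\<Sum>a<N. x a * f (lp_unit a)) \<le> C * lp_norm p x" if x: "x \<in> lp_space p" for x N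
  proof -
    have "norm (\<Sum>a<N. x a * (f (lp_unit a) * lp_unit 0 0)) \<le> C * lp_norm p x"
      by (rule lp_op_partial_bound[OF lp_dual_op[OF assms] x C])
    then show ?thesis by (simp add: lp_unit_def[of 0])
  qed
  then show thesis using that C by blast
qed

text \<open>Integrating coordinates defines the candidate \<open>E\<close>, and Jensen's inequality
  keeps it in the space with the same bound. An arbitrary functional is a limit of finite
  combinations of coordinates, so dominated convergence extends the defining identity to it.\<close>

lemma pettis_integral_exists:
  fixes A :: "'w \<Rightarrow> (nat \<Rightarrow> 'k::{real_normed_field,banach,second_countable_topology}) \<Rightarrow> (nat \<Rightarrow> 'k)"
  assumes "prob_space M" and A_op: "\<And>\<omega>. \<omega> \<in> space M \<Longrightarrow> lp_op p (A \<omega>)"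
    and meas: "weakly_measurable M p A" and \<rho>: "0 \<le> \<rho>"
    and bd: "\<And>\<omega> y. \<omega> \<in> space M \<Longrightarrow> y \<in> lp_space p \<Longrightarrow> lp_norm p (A \<omega> y) \<le> \<rho> * lp_norm p y"
  shows "\<exists>E. is_pettis_integral M p A E"
proof -
  interpret prob_space M by fact
  have coord_meas: "(\<lambda>\<omega>. A \<omega> x j) \<in> borel_measurable M" if "x \<in> lp_space p" for x j
    using meas that lp_dual_coord[of j] unfolding weakly_measurable_def by blast
  have coord_bd: "norm (A \<omega> x j) \<le> \<rho> * lp_norm p x" if "x \<in> lp_space p" "\<omega> \<in> space M" for x j \<omega>
    using lp_norm_coord[OF lp_op_space[OF A_op[OF that(2)] that(1)], of j] bd[OF that(2,1)] by linarith
  have coord_int: "integrable M (\<lambda>\<omega>. A \<omega> x j)" if "x \<in> lp_space p" for x j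
    using coord_bd that by (intro integrable_const_bound[OF AE_I2 coord_meas]) auto
  define E where "E x j = (\<integral>\<omega>. A \<omega> x j \<partial>M)" for x j
  have powr_int: "integrable M (\<lambda>\<omega>. norm (A \<omega> x i) powr p)" if x: "x \<in> lp_space p" for x i
  proof (rule integrable_const_bound)
    have [measurable]: "(\<lambda>\<omega>. A \<omega> x i) \<in> borel_measurable M" by (rule coord_meas[OF x])
    show "(\<lambda>\<omega>. norm (A \<omega> x i) powr p) \<in> borel_measurable M" by measurable
    show "AE \<omega> in M. norm (norm (A \<omega> x i) powr p) \<le> (\<rho> * lp_norm p x) powr p"
      using one_le_p coord_bd[OF x] by (intro AE_I2) (auto intro!: powr_mono2)
  qed
  have E_partial: "(\<Sum>i<n. norm (E x i) powr p) \<le> (\<rho> * lp_norm p x) powr p" if x: "x \<in> lp_space p" for x n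
  proof -
    have "norm (E x i) powr p \<le> (\<integral>\<omega>. norm (A \<omega> x i) powr p \<partial>M)" for i
    proof -
      have "norm (E x i) \<le> (\<integral>\<omega>. norm (A \<omega> x i) \<partial>M)" unfolding E_def by (rule integral_norm_bound)
      then have "norm (E x i) powr p \<le> \<bar>\<integral>\<omega>. norm (A \<omega> x i) \<partial>M\<bar> powr p"
        using one_le_p by (intro powr_mono2) auto
      \<comment> \<open>Jensen's inequality, coordinate by coordinate; summed under one integral,
        the right-hand sides are bounded by the pointwise norm of
        \<open>A \<omega> x\<close>.\<close>
      also have "\<dots> \<le> (\<integral>\<omega>. \<bar>norm (A \<omega> x i)\<bar> powr p \<partial>M)"
        using powr_int[OF x] coord_int[OF x]
        by (intro jensens_inequality[where I = UNIV and q = "\<lambda>u. \<bar>u\<bar> powr p"] convex_on_abs_powr one_le_p) auto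
      finally show ?thesis by simp
    qed
    then have "(\<Sum>i<n. norm (E x i) powr p) \<le> (\<Sum>i<n. \<integral>\<omega>. norm (A \<omega> x i) powr p \<partial>M)" by (rule sum_mono)
    also have "\<dots> = (\<integral>\<omega>. (\<Sum>i<n. norm (A \<omega> x i) powr p) \<partial>M)"
      using powr_int[OF x] by simp
    also have "\<dots> \<le> (\<rho> * lp_norm p x) powr p"
    proof (rule integral_le_const)
      show "integrable M (\<lambda>\<omega>. \<Sum>i<n. norm (A \<omega> x i) powr p)"
        by (rule Bochner_Integration.integrable_sum[OF powr_int[OF x]])
      show "AE \<omega> in M. (\<Sum>i<n. norm (A \<omega> x i) powr p) \<le> (\<rho> * lp_norm p x) powr p"
      proof (rule AE_I2)
        fix \<omega> assume \<omega>: "\<omega> \<in> space M"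
        have "(\<Sum>i<n. norm (A \<omega> x i) powr p) \<le> lp_norm p (A \<omega> x) powr p"
          by (rule lp_norm_partial[OF lp_op_space[OF A_op[OF \<omega>] x]]) simp
        also have "\<dots> \<le> (\<rho> * lp_norm p x) powr p"
          using one_le_p bd[OF \<omega> x] by (intro powr_mono2) auto
        finally show "(\<Sum>i<n. norm (A \<omega> x i) powr p) \<le> (\<rho> * lp_norm p x) powr p" .
      qed
    qed
    finally show ?thesis .
  qed
  have E_lp: "E x \<in> lp_space p" "lp_norm p (E x) \<le> \<rho> * lp_norm p x" if "x \<in> lp_space p" for x
    using lp_normI[OF E_partial[OF that]] \<rho> by auto
  have "lp_op p E"
    unfolding lp_op_def
  proof (intro conjI ballI allI)
    fix x y :: "nat \<Rightarrow> 'k" assume x: "x \<in> lp_space p" and y: "y \<in> lp_space p"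
    show "E (\<lambda>i. x i + y i) = (\<lambda>i. E x i + E y i)"
    proof
      fix j
      have "E (\<lambda>i. x i + y i) j = (\<integral>\<omega>. A \<omega> x j + A \<omega> y j \<partial>M)"
        unfolding E_def using lp_op_add[OF A_op x y] by (intro Bochner_Integration.integral_cong) auto
      then show "E (\<lambda>i. x i + y i) j = E x j + E y j"
        unfolding E_def using coord_int x y by simp
    qed
  next
    fix x :: "nat \<Rightarrow> 'k" and c assume x: "x \<in> lp_space p"
    show "E (\<lambda>i. c * x i) = (\<lambda>i. c * E x i)"
    proof
      fix j
      have "E (\<lambda>i. c * x i) j = (\<integral>\<omega>. c * A \<omega> x j \<partial>M)"
        unfolding E_def using lp_op_scale[OF A_op x] by (intro Bochner_Integration.integral_cong) auto
      then show "E (\<lambda>i. c * x i) j = c * E x j" unfolding E_def by simp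
    qed
  qed (use E_lp in auto)
  moreover have "integrable M (\<lambda>\<omega>. f (A \<omega> x)) \<and> (\<integral>\<omega>. f (A \<omega> x) \<partial>M) = f (E x)"
    if x: "x \<in> lp_space p" and f: "lp_dual p f" for x f
  proof -
    obtain C where C: "0 \<le> C" "\<And>x N. x \<in> lp_space p \<Longrightarrow> norm (\<Sum>a<N. x a * f (lp_unit a)) \<le> C * lp_norm p x"
      using lp_dual_partial_bound[OF f] by blast
    have f_meas: "(\<lambda>\<omega>. f (A \<omega> x)) \<in> borel_measurable M"
      using meas x f unfolding weakly_measurable_def by blast
    have [measurable]: "(\<lambda>\<omega>. A \<omega> x j) \<in> borel_measurable M" for j by (rule coord_meas[OF x])
    have s_meas: "(\<lambda>\<omega>. \<Sum>a<N. A \<omega> x a * f (lp_unit a)) \<in> borel_measurable M" for N by measurable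
    have lim: "AE \<omega> in M. (\<lambda>N. \<Sum>a<N. A \<omega> x a * f (lp_unit a)) \<longlonglongrightarrow> f (A \<omega> x)"
      using lp_dual_tendsto[OF f lp_op_space[OF A_op x]] by (intro AE_I2)
    have dom: "AE \<omega> in M. norm (\<Sum>a<N. A \<omega> x a * f (lp_unit a)) \<le> C * (\<rho> * lp_norm p x)" for N
    proof (rule AE_I2)
      fix \<omega> assume \<omega>: "\<omega> \<in> space M"
      show "norm (\<Sum>a<N. A \<omega> x a * f (lp_unit a)) \<le> C * (\<rho> * lp_norm p x)"
        using C(2)[OF lp_op_space[OF A_op[OF \<omega>] x], of N] mult_left_mono[OF bd[OF \<omega> x] C(1)] by linarith
    qed
    have 1: "(\<lambda>N. \<integral>\<omega>. (\<Sum>a<N. A \<omega> x a * f (lp_unit a)) \<partial>M) \<longlonglongrightarrow> (\<integral>\<omega>. f (A \<omega> x) \<partial>M)"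
      by (rule integral_dominated_convergence[OF f_meas s_meas _ lim dom]) simp
    have 2: "integrable M (\<lambda>\<omega>. f (A \<omega> x))"
      by (rule integrable_dominated_convergence[OF f_meas s_meas _ lim dom]) simp
    have "(\<integral>\<omega>. (\<Sum>a<N. A \<omega> x a * f (lp_unit a)) \<partial>M) = (\<Sum>a<N. E x a * f (lp_unit a))" for N
      unfolding E_def using coord_int[OF x] by simp
    then have "(\<integral>\<omega>. f (A \<omega> x) \<partial>M) = f (E x)"
      using LIMSEQ_unique[OF 1] lp_dual_tendsto[OF f E_lp(1)[OF x]] by simp
    then show ?thesis using 2 by blast
  qed
  ultimately show ?thesis unfolding is_pettis_integral_def by blast
qed

section \<open>Operator bounds from countably many test vectors\<close>

definition list_vec :: "'k list \<Rightarrow> nat \<Rightarrow> 'k::real_normed_field" where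
  "list_vec l = (\<lambda>i. if i < length l then l ! i else 0)"

lemma list_vec_lp: "list_vec l \<in> lp_space p"
proof -
  have "list_vec l = lp_trunc (length l) (list_vec l)"
    by (auto simp: list_vec_def lp_trunc_def)
  also have "\<dots> \<in> lp_space p"
    unfolding lp_trunc_eq_sum by (intro lp_sum lp_scale lp_unit)
  finally show ?thesis .
qed

text \<open>Truncate, then approximate the finitely many remaining coordinates from
  \<open>D\<close>. For countable \<open>D\<close> the finite lists over it are countable too, so
  almost sure statements about them can be combined.\<close>

lemma list_vec_dense:
  fixes y :: "nat \<Rightarrow> 'k::real_normed_field"
  assumes D: "\<And>U :: 'k set. open U \<Longrightarrow> U \<noteq> {} \<Longrightarrow> \<exists>d\<in>D. d \<in> U"
    and y: "y \<in> lp_space p" and e: "0 < e"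
  shows "\<exists>l\<in>lists D. lp_norm p (\<lambda>i. y i - list_vec l i) < e"
proof -
  have "\<forall>\<^sub>F N in sequentially. lp_norm p (\<lambda>i. y i - lp_trunc N y i) < e / 2"
    by (rule order_tendstoD[OF lp_trunc_tendsto[OF y]]) (use e in simp)
  then obtain N where N: "lp_norm p (\<lambda>i. y i - lp_trunc N y i) < e / 2"
    by (auto simp: eventually_sequentially)
  \<comment> \<open>At most \<open>N\<close> coordinate errors of this size add up to no more than
    \<open>e / 2\<close>; adding 1 covers \<open>N = 0\<close>.\<close>
  define \<delta> where "\<delta> = e / (2 * (real N + 1))"
  have \<delta>: "0 < \<delta>" using e by (simp add: \<delta>_def)
  have "\<exists>d\<in>D. d \<in> ball (y i) \<delta>" for i using D[of "ball (y i) \<delta>"] \<delta> by auto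
  then obtain d where d: "\<And>i. d i \<in> D" "\<And>i. norm (y i - d i) < \<delta>"
    by (metis dist_norm mem_ball)
  define l where "l = map d [0..<N]"
  have l: "l \<in> lists D" using d by (auto simp: l_def)
  have diff: "(\<lambda>i. lp_trunc N y i - list_vec l i) = (\<lambda>i. \<Sum>a<N. (y a - d a) * lp_unit a i)"
    unfolding lp_trunc_eq_sum[symmetric] by (auto simp: lp_trunc_def list_vec_def l_def)
  have "lp_norm p (\<lambda>i. lp_trunc N y i - list_vec l i) \<le> (\<Sum>a<N. lp_norm p (\<lambda>i. (y a - d a) * lp_unit a i))"
    unfolding diff by (intro lp_sum lp_scale lp_unit)
  also have "\<dots> = (\<Sum>a<N. norm (y a - d a))"
    by (simp add: lp_scale(2)[OF lp_unit] lp_norm_unit)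
  also have "\<dots> \<le> (\<Sum>a<N. \<delta>)" using d by (intro sum_mono) (simp add: less_imp_le)
  also have "\<dots> \<le> e / 2" using e by (simp add: \<delta>_def field_simps)
  finally have 2: "lp_norm p (\<lambda>i. lp_trunc N y i - list_vec l i) \<le> e / 2" .
  have "(\<lambda>i. y i - list_vec l i) = (\<lambda>i. (y i - lp_trunc N y i) + (lp_trunc N y i - list_vec l i))" by auto
  moreover have "lp_norm p (\<lambda>i. (y i - lp_trunc N y i) + (lp_trunc N y i - list_vec l i))
     \<le> lp_norm p (\<lambda>i. y i - lp_trunc N y i) + lp_norm p (\<lambda>i. lp_trunc N y i - list_vec l i)"
    using y lp_trunc(1)[OF y] list_vec_lp by (intro lp_add lp_diff)
  ultimately have "lp_norm p (\<lambda>i. y i - list_vec l i) < e" using N 2 by simp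
  then show ?thesis using l by blast
qed

text \<open>The operator is already continuous with some constant \<open>C\<close>. That suffices to
  carry the bound \<open>\<rho>\<close> from the dense set to all vectors, the error being
  \<open>(\<rho> + C)\<close> times the distance.\<close>

lemma bound_from_dense:
  fixes L :: "(nat \<Rightarrow> 'k::real_normed_field) \<Rightarrow> (nat \<Rightarrow> 'k)"
  assumes D: "\<And>U :: 'k set. open U \<Longrightarrow> U \<noteq> {} \<Longrightarrow> \<exists>d\<in>D. d \<in> U" and L: "lp_op p L" and \<rho>: "0 \<le> \<rho>"
    and bd: "\<And>l. l \<in> lists D \<Longrightarrow> lp_norm p (L (list_vec l)) \<le> \<rho> * lp_norm p (list_vec l)"
    and y: "y \<in> lp_space p"
  shows "lp_norm p (L y) \<le> \<rho> * lp_norm p y"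
proof (rule field_le_epsilon)
  fix e :: real assume e: "0 < e"
  obtain C where C: "0 \<le> C" "\<And>x. x \<in> lp_space p \<Longrightarrow> lp_norm p (L x) \<le> C * lp_norm p x"
    using lp_op_bound[OF L] by blast
  obtain l where l: "l \<in> lists D" "lp_norm p (\<lambda>i. y i - list_vec l i) < e / (\<rho> + C + 1)"
    using list_vec_dense[OF D y, of "e / (\<rho> + C + 1)"] e \<rho> C by auto
  let ?v = "list_vec l" and ?d = "\<lambda>i. y i - list_vec l i"
  have v: "?v \<in> lp_space p" by (rule list_vec_lp)
  have d: "?d \<in> lp_space p" using y v by (rule lp_diff)
  have "L y = (\<lambda>i. L ?v i + L ?d i)" using lp_op_diff[OF L y v] by simp
  then have "lp_norm p (L y) \<le> lp_norm p (L ?v) + lp_norm p (L ?d)"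
    using lp_add(2)[OF lp_op_space[OF L v] lp_op_space[OF L d]] by simp
  also have "\<dots> \<le> \<rho> * lp_norm p ?v + C * lp_norm p ?d" using bd[OF l(1)] C(2)[OF d] by simp
  also have "lp_norm p ?v \<le> lp_norm p y + lp_norm p ?d" using lp_diff(2)[OF y d] by simp
  then have "\<rho> * lp_norm p ?v + C * lp_norm p ?d \<le> \<rho> * lp_norm p y + (\<rho> + C) * lp_norm p ?d"
    using mult_left_mono[OF _ \<rho>] by (fastforce simp: algebra_simps)
  also have "(\<rho> + C) * lp_norm p ?d \<le> (\<rho> + C + 1) * (e / (\<rho> + C + 1))"
    using l(2) \<rho> C by (intro mult_mono) auto
  also have "\<dots> = e" using \<rho> C by simp
  finally show "lp_norm p (L y) \<le> \<rho> * lp_norm p y + e" by simp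
qed

end

section \<open>From the hypotheses to the locale of random operators\<close>

theorem theorem1:
  fixes M :: "'w measure" and p \<rho> T \<epsilon> :: real
    and A :: "'w \<Rightarrow> (nat \<Rightarrow> 'k::{real_normed_field,banach,second_countable_topology}) \<Rightarrow> (nat \<Rightarrow> 'k)"
    and As :: "nat \<Rightarrow> 'w \<Rightarrow> (nat \<Rightarrow> 'k) \<Rightarrow> (nat \<Rightarrow> 'k)"
    and x :: "nat \<Rightarrow> 'k"
  assumes "prob_space M"
    and "1 \<le> p" "p \<le> 2"
    and "\<forall>\<omega>\<in>space M. lp_op p (A \<omega>)"
    and "weakly_measurable M p A"
    and "\<forall>\<omega>\<in>space M. \<forall>y\<in>lp_space p. lp_norm p (A \<omega> y) \<le> \<rho> * lp_norm p y"
    and "\<forall>i. \<forall>\<omega>\<in>space M. lp_op p (As i \<omega>)"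
    and "\<forall>i. weakly_measurable M p (As i)"
    and "\<forall>f xs. (\<forall>i. lp_dual p (f i)) \<and> (\<forall>i. xs i \<in> lp_space p) \<longrightarrow>
           prob_space.indep_vars M (\<lambda>_. borel) (\<lambda>i \<omega>. f i (As i \<omega> (xs i))) UNIV"
    and "\<forall>i (m::nat) F X. (\<forall>k<m. lp_dual p (F k)) \<and> (\<forall>k<m. X k \<in> lp_space p) \<longrightarrow>
           distr M (PiM {..<m} (\<lambda>_. borel)) (\<lambda>\<omega>. \<lambda>k\<in>{..<m}. F k (As i \<omega> (X k)))
         = distr M (PiM {..<m} (\<lambda>_. borel)) (\<lambda>\<omega>. \<lambda>k\<in>{..<m}. F k (A \<omega> (X k)))"
    and "x \<in> lp_space p" and "T > 0" and "\<epsilon> > 0"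
  shows "(\<lambda>n. outer_prob M {\<omega>\<in>space M.
            (SUP t\<in>{0..T}. ereal (lp_norm 2 (\<lambda>j. W_op p (\<lambda>i. As i \<omega>) n t x j
                 - op_exp p (pettis_expectation M p A) t x j))) > ereal \<epsilon>})
         \<longlonglongrightarrow> 0"
proof -
  interpret prob_space M by fact
  interpret lp_exponent p by unfold_locales fact
  \<comment> \<open>A nonnegative version of the bound, which the monotonicity steps below can use
    directly.\<close>
  define \<rho>' where "\<rho>' = max \<rho> 0"
  have \<rho>': "0 \<le> \<rho>'" by (simp add: \<rho>'_def)
  have A_op: "lp_op p (A \<omega>)" if "\<omega> \<in> space M" for \<omega> using assms(4) that by blast
  have As_op: "lp_op p (As i \<omega>)" if "\<omega> \<in> space M" for i \<omega> using assms(7) that by blast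
  have A_bd: "lp_norm p (A \<omega> y) \<le> \<rho>' * lp_norm p y" if "\<omega> \<in> space M" "y \<in> lp_space p" for \<omega> y
  proof -
    have "\<rho> * lp_norm p y \<le> \<rho>' * lp_norm p y" by (intro mult_right_mono) (auto simp: \<rho>'_def)
    then show ?thesis using assms(6) that by force
  qed
  let ?E = "pettis_expectation M p A"
  \<comment> \<open>The expectation is a Hilbert choice, so its defining property rests on
    existence.\<close>
  have "is_pettis_integral M p A ?E"
    unfolding pettis_expectation_def
    by (rule someI_ex[OF pettis_integral_exists[OF assms(1) A_op assms(5) \<rho>' A_bd]])
  then have E_op: "lp_op p ?E"
    and E_mean: "\<And>x f. x \<in> lp_space p \<Longrightarrow> lp_dual p f \<Longrightarrow> (\<integral>\<omega>. f (A \<omega> x) \<partial>M) = f (?E x)"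
    unfolding is_pettis_integral_def by auto
  obtain C where C: "0 \<le> C" "\<And>x. x \<in> lp_space p \<Longrightarrow> lp_norm p (?E x) \<le> C * lp_norm p x"
    using lp_op_bound[OF E_op] by blast
  \<comment> \<open>The locale asks for a common constant for the operators and their mean;
    \<open>C\<close> is any bound that \<open>lp_op\<close> supplies for the mean.\<close>
  define r where "r = max \<rho>' C"
  have A_meas: "(\<lambda>\<omega>. A \<omega> y j) \<in> borel_measurable M" if "y \<in> lp_space p" for y j
    using assms(5) that lp_dual_coord[of j] unfolding weakly_measurable_def by blast
  have As_meas: "(\<lambda>\<omega>. As i \<omega> y j) \<in> borel_measurable M" if "y \<in> lp_space p" for i y j
    using assms(8) that lp_dual_coord[of j] unfolding weakly_measurable_def by blast
  let ?P = "\<lambda>m::nat. PiM {..<m} (\<lambda>_. borel :: 'k measure)"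
  let ?fA = "\<lambda>m js y \<omega>. \<lambda>k\<in>{..<m::nat}. A \<omega> y (js k)"
  let ?fAs = "\<lambda>i m js y \<omega>. \<lambda>k\<in>{..<m::nat}. As i \<omega> y (js k)"
  have fA: "?fA m js y \<in> measurable M (?P m)" if "y \<in> lp_space p" for m js y
    using A_meas[OF that] by (intro measurable_restrict)
  have fAs: "?fAs i m js y \<in> measurable M (?P m)" if "y \<in> lp_space p" for i m js y
    using As_meas[OF that] by (intro measurable_restrict)
  have law: "distr M (?P m) (?fAs i m js y) = distr M (?P m) (?fA m js y)" if "y \<in> lp_space p" for i m js y
    using assms(10)[rule_format, of m "\<lambda>k x. x (js k)" "\<lambda>_. y" i] that by (simp add: lp_dual_coord)
  have As_mean: "(\<integral>\<omega>. As i \<omega> y j \<partial>M) = ?E y j" if y: "y \<in> lp_space p" for i y j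
  proof -
    \<comment> \<open>Equality of laws with a single pair of functional and vector already gives
      equality of means.\<close>
    have cm: "(\<lambda>v. v 0) \<in> borel_measurable (?P 1)" by (rule measurable_component_singleton) simp
    have "(\<integral>\<omega>. As i \<omega> y j \<partial>M) = (\<integral>v. v 0 \<partial>distr M (?P 1) (?fAs i 1 (\<lambda>_. j) y))"
      by (subst integral_distr[OF fAs[OF y] cm]) simp
    also have "\<dots> = (\<integral>\<omega>. A \<omega> y j \<partial>M)"
      unfolding law[OF y] by (subst integral_distr[OF fA[OF y] cm]) simp
    also have "\<dots> = ?E y j" using E_mean[OF y lp_dual_coord[of j]] .
    finally show ?thesis .
  qed
  \<comment> \<open>The norm involves infinitely many coordinates but the laws only finitely many.
    Hence the bound is transferred for the first \<open>m\<close> coordinates jointly, and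
    \<open>m\<close> then runs over a countable set.\<close>
  have As_bd1: "AE \<omega> in M. lp_norm p (As i \<omega> y) \<le> \<rho>' * lp_norm p y" if y: "y \<in> lp_space p" for i y
  proof -
    have "AE \<omega> in M. (\<Sum>k<m. norm (As i \<omega> y k) powr p) \<le> (\<rho>' * lp_norm p y) powr p" for m
    proof -
      let ?Q = "\<lambda>v. (\<Sum>k<m. norm (v k) powr p) \<le> (\<rho>' * lp_norm p y) powr p"
      have [measurable]: "(\<lambda>v. v k) \<in> borel_measurable (?P m)" if "k < m" for k
        using that by (intro measurable_component_singleton) simp
      have "(\<lambda>v. \<Sum>k<m. norm (v k) powr p) \<in> borel_measurable (?P m)"
        by (rule borel_measurable_sum) (simp, measurable)
      then have Q: "{v \<in> space (?P m). ?Q v} \<in> sets (?P m)" by measurable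
      have "AE \<omega> in M. ?Q (?fA m (\<lambda>k. k) y \<omega>)"
      proof (rule AE_I2)
        fix \<omega> assume \<omega>: "\<omega> \<in> space M"
        have "(\<Sum>k<m. norm (A \<omega> y k) powr p) \<le> lp_norm p (A \<omega> y) powr p"
          by (rule lp_norm_partial[OF lp_op_space[OF A_op[OF \<omega>] y]]) simp
        also have "\<dots> \<le> (\<rho>' * lp_norm p y) powr p"
          using one_le_p A_bd[OF \<omega> y] by (intro powr_mono2) auto
        finally show "?Q (?fA m (\<lambda>k. k) y \<omega>)" by simp
      qed
      then have "AE v in distr M (?P m) (?fAs i m (\<lambda>k. k) y). ?Q v"
        unfolding law[OF y] by (subst AE_distr_iff[OF fA[OF y] Q])
      then have "AE \<omega> in M. ?Q (?fAs i m (\<lambda>k. k) y \<omega>)"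
        by (subst (asm) AE_distr_iff[OF fAs[OF y] Q])
      then show ?thesis by simp
    qed
    then have "AE \<omega> in M. \<forall>m. (\<Sum>k<m. norm (As i \<omega> y k) powr p) \<le> (\<rho>' * lp_norm p y) powr p"
      by (simp add: AE_all_countable)
    then show ?thesis
      by eventually_elim (rule lp_normI(2), use \<rho>' in auto)
  qed
  \<comment> \<open>So far the exceptional null set depends on the vector. Countably many test
    vectors, and countably many indices \<open>i\<close>, leave a single null set; boundedness of
    each \<open>As i \<omega>\<close> handles the other vectors.\<close>
  obtain D :: "'k set" where D: "countable D" "\<And>U. open U \<Longrightarrow> U \<noteq> {} \<Longrightarrow> \<exists>d\<in>D. d \<in> U"
    using countable_dense_setE by blast
  have "AE \<omega> in M. \<forall>l\<in>lists D. lp_norm p (As i \<omega> (list_vec l)) \<le> \<rho>' * lp_norm p (list_vec l)" for i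
    using D(1) by (subst AE_ball_countable) (auto intro: As_bd1 list_vec_lp)
  then have "AE \<omega> in M. \<forall>i. \<forall>l\<in>lists D. lp_norm p (As i \<omega> (list_vec l)) \<le> \<rho>' * lp_norm p (list_vec l)"
    by (simp add: AE_all_countable)
  then have As_bd: "AE \<omega> in M. \<forall>i. \<forall>y\<in>lp_space p. lp_norm p (As i \<omega> y) \<le> r * lp_norm p y"
    using AE_space
  proof eventually_elim
    case (elim \<omega>)
    show ?case
    proof (intro allI ballI)
      fix i and y :: "nat \<Rightarrow> 'k" assume y: "y \<in> lp_space p"
      have "lp_norm p (As i \<omega> y) \<le> \<rho>' * lp_norm p y"
        using elim(1) by (intro bound_from_dense[OF D(2) As_op[OF elim(2)] \<rho>' _ y]) auto
      also have "\<dots> \<le> r * lp_norm p y" by (intro mult_right_mono) (auto simp: r_def)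
      finally show "lp_norm p (As i \<omega> y) \<le> r * lp_norm p y" .
    qed
  qed
  interpret random_lp_ops p M As ?E r
  proof
    show "lp_norm p (?E y) \<le> r * lp_norm p y" if "y \<in> lp_space p" for y
      by (rule order_trans[OF C(2)[OF that]]) (intro mult_right_mono, auto simp: r_def)
    show "indep_vars (\<lambda>_. borel) (\<lambda>i \<omega>. As i \<omega> (xs i) (js i)) UNIV" if "\<And>i. xs i \<in> lp_space p" for xs js
      using assms(9)[rule_format, of "\<lambda>i x. x (js i)" xs] that by (simp add: lp_dual_coord)
  qed (use assms As_op As_meas As_bd As_mean E_op \<rho>' in \<open>auto simp: r_def\<close>)
  show ?thesis by (rule product_converges_in_probability) fact+
qed

end
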